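(* Let $A\subset\mathbb{R}^m$ be compact, let $f:\mathbb{R}^n\times A\to\mathbb{R}^n$ be of class $C^2$ and let $u:\mathbb{R}^n\to\mathbb{R}$ be of class $C^3$. Let $\bar x\in\mathbb{R}^n$ be a point such that $\nabla u(\bar x)\neq 0$ and $\nabla u(\bar x)\cdot f(\bar x,a)=0$ for all $a\in A$. For $a_1,a_2\in A$ write $F_{a_1,a_2}(x)=f(x,a_1)+f(x,a_2)$. Suppose that $$\max_{(a_1,a_2)\in A\times A}\Big\{-\mathrm{Tr}\big(D^2u(\bar x)\,F_{a_1,a_2}(\bar x)\otimes F_{a_1,a_2}(\bar x)\big)-\Big(DF_{a_1,a_2}(\bar x)\,F_{a_1,a_2}(\bar x)+[f(\cdot,a_1),f(\cdot,a_2)](\bar x)\Big)\cdot\nabla u(\bar x)\Big\}>0 .$$ Then the target $\mathcal T=\{x:u(x)\le u(\bar x)\}$ is STLA at $\bar x$ for the system $\dot x_t=f(x_t,a_t)$, and there are $C,r>0$ such that the minimum time function $T$ of the system with target $\mathcal T$ satisfies $$T(x)\le C|x-\bar x|^{1/2}\quad\text{for all }x\text{ with }|x-\bar x|\le r.$$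
   Context: System: $\dot x_t=f(x_t,a_t)$, $x_0\in\mathbb{R}^n$, where the controls $a_\cdot:[0,+\infty)\to A$ are piecewise continuous (finitely many pieces on bounded intervals); a trajectory is the corresponding solution on its maximal interval of existence. "$f$ is of class $C^k$" means that all spatial partial derivatives of $f$ up to order $k$ exist and are jointly continuous in $(x,a)\in\mathbb{R}^n\times A$. Minimum time function for a target $\mathcal T$: $T(x)=\inf_{a_\cdot}t_x(a_\cdot)$ over all admissible controls, where $t_x(a_\cdot)=\inf\{t\ge 0: x_t\in\mathcal T\}$, $x_\cdot$ being the trajectory with control $a_\cdot$ and $x_0=x$ ($\inf\emptyset=+\infty$). In particular $T\equiv0$ on $\mathcal T$. The target $\mathcal T$ is small time locally attainable (STLA) at $\bar x$ for the system if for every $t>0$ the point $\bar x$ is in the interior of the set of points from which $\mathcal T$ can be reached in time less than $t$ following trajectories of the system (equivalently, $T$ is continuous at $\bar x$). Notation: $Df(x)=(\partial_{x_j}f_i)_{i,j}$ is the spatial Jacobian; $[f,g](x)=Dg(x)f(x)-Df(x)g(x)$ is the Lie bracket; $D^2u$ is the Hessian; $p\otimes q=p\,{}^tq$, so $\mathrm{Tr}(D^2u\,p\otimes q)=D^2u\,p\cdot q$. *)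

theory Defs
  imports "HOL-Analysis.Analysis"
begin

definition has_partial :: "'n::finite \<Rightarrow> (real^'n \<Rightarrow> 'b::real_normed_vector) \<Rightarrow> real^'n \<Rightarrow> bool" where
  "has_partial j g x \<longleftrightarrow> (\<lambda>s. g (x + s *\<^sub>R axis j 1)) differentiable (at 0)"

definition partial :: "'n::finite \<Rightarrow> (real^'n \<Rightarrow> 'b::real_normed_vector) \<Rightarrow> real^'n \<Rightarrow> 'b" where
  "partial j g x = vector_derivative (\<lambda>s. g (x + s *\<^sub>R axis j 1)) (at 0)"

fun iterated_partial :: "'n::finite list \<Rightarrow> (real^'n \<Rightarrow> 'b::real_normed_vector) \<Rightarrow> real^'n \<Rightarrow> 'b" where
  "iterated_partial [] g = g"
| "iterated_partial (j # js) g = partial j (iterated_partial js g)"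

definition has_partials_upto :: "nat \<Rightarrow> (real^'n::finite \<Rightarrow> 'b::real_normed_vector) \<Rightarrow> bool" where
  "has_partials_upto k g \<longleftrightarrow>
     (\<forall>js. length js < k \<longrightarrow> (\<forall>j x. has_partial j (iterated_partial js g) x))"

definition class_C :: "nat \<Rightarrow> (real^'n::finite \<Rightarrow> 'b::real_normed_vector) \<Rightarrow> bool" where
  "class_C k g \<longleftrightarrow> has_partials_upto k g \<and>
     (\<forall>js. length js \<le> k \<longrightarrow> continuous_on UNIV (iterated_partial js g))"

text \<open>For a controlled field \<open>f(x,a)\<close> only derivatives in \<open>x\<close> are taken, but they are required
  to be jointly continuous in \<open>(x,a)\<close>; values of \<open>f\<close> for \<open>a\<close> outside \<open>A\<close> are irrelevant.\<close>

definition spatial_class_C ::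
  "nat \<Rightarrow> 'a::topological_space set \<Rightarrow> (real^'n::finite \<Rightarrow> 'a \<Rightarrow> 'b::real_normed_vector) \<Rightarrow> bool" where
  "spatial_class_C k A f \<longleftrightarrow> (\<forall>a\<in>A. has_partials_upto k (\<lambda>x. f x a)) \<and>
     (\<forall>js. length js \<le> k \<longrightarrow>
        continuous_on (UNIV \<times> A) (\<lambda>(x, a). iterated_partial js (\<lambda>y. f y a) x))"

definition grad :: "(real^'n::finite \<Rightarrow> real) \<Rightarrow> real^'n \<Rightarrow> real^'n" where
  "grad u x = (\<chi> j. partial j u x)"

definition hessian :: "(real^'n::finite \<Rightarrow> real) \<Rightarrow> real^'n \<Rightarrow> real^'n^'n" where
  "hessian u x = (\<chi> i j. iterated_partial [i, j] u x)"

definition jac :: "(real^'n::finite \<Rightarrow> real^'n) \<Rightarrow> real^'n \<Rightarrow> real^'n^'n" where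
  "jac g x = (\<chi> i j. partial j (\<lambda>y. g y $ i) x)"

definition lie_bracket ::
  "(real^'n::finite \<Rightarrow> real^'n) \<Rightarrow> (real^'n \<Rightarrow> real^'n) \<Rightarrow> real^'n \<Rightarrow> real^'n" where
  "lie_bracket f g x = jac g x *v f x - jac f x *v g x"

definition outer :: "real^'n::finite \<Rightarrow> real^'n \<Rightarrow> real^'n^'n" where
  "outer p q = (\<chi> i j. p $ i * q $ j)"

text \<open>Only the restriction of a control to \<open>[0,\<infinity>)\<close> matters. The one-sided limits rule out
  oscillating discontinuities; the value at a jump is unconstrained.\<close>

definition piecewise_continuous :: "(real \<Rightarrow> 'a::topological_space) \<Rightarrow> bool" where
  "piecewise_continuous a \<longleftrightarrow>
     (\<forall>b. finite {t\<in>{0..b}. \<not> continuous (at t within {0..}) a}) \<and>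
     (\<forall>t\<ge>0. \<exists>l. (a \<longlongrightarrow> l) (at_right t)) \<and>
     (\<forall>t>0. \<exists>l. (a \<longlongrightarrow> l) (at_left t))"

definition controls :: "'a::topological_space set \<Rightarrow> (real \<Rightarrow> 'a) set" where
  "controls A = {a. (\<forall>t\<ge>0. a t \<in> A) \<and> piecewise_continuous a}"

text \<open>A solution is continuous and satisfies the equation except at the discontinuities of the
  control. At an end point of \<open>J\<close> the derivative is one-sided, and for \<open>J = {0}\<close> it is void.\<close>

definition solution_on ::
  "('x::real_normed_vector \<Rightarrow> 'a::topological_space \<Rightarrow> 'x) \<Rightarrow> (real \<Rightarrow> 'a) \<Rightarrow> 'x \<Rightarrow> real set \<Rightarrow> (real \<Rightarrow> 'x) \<Rightarrow> bool"
  where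
  "solution_on f a x0 J y \<longleftrightarrow>
     is_interval J \<and> 0 \<in> J \<and> J \<subseteq> {0..} \<and> y 0 = x0 \<and> continuous_on J y \<and>
     (\<forall>t\<in>J. continuous (at t within {0..}) a \<longrightarrow>
        (y has_vector_derivative f (y t) (a t)) (at t within J))"

definition trajectory ::
  "('x::real_normed_vector \<Rightarrow> 'a::topological_space \<Rightarrow> 'x) \<Rightarrow> (real \<Rightarrow> 'a) \<Rightarrow> 'x \<Rightarrow> real set \<Rightarrow> (real \<Rightarrow> 'x) \<Rightarrow> bool"
  where
  "trajectory f a x0 J y \<longleftrightarrow> solution_on f a x0 J y \<and>
     (\<forall>J' y'. solution_on f a x0 J' y' \<and> J \<subseteq> J' \<and> (\<forall>t\<in>J. y' t = y t) \<longrightarrow> J' = J)"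

text \<open>For a field that is \<open>C\<^sup>1\<close> in the state the trajectory of a given control and initial point is
  unique, so quantifying it existentially below amounts to speaking of \<^emph>\<open>the\<close> trajectory.
  Infima are taken in the extended reals, where the infimum of the empty set is \<open>\<infinity>\<close>.\<close>

definition hitting_time ::
  "('x::real_normed_vector \<Rightarrow> 'a::topological_space \<Rightarrow> 'x) \<Rightarrow> 'x set \<Rightarrow> (real \<Rightarrow> 'a) \<Rightarrow> 'x \<Rightarrow> ereal" where
  "hitting_time f S a x = Inf {ereal t | t. \<exists>J y. trajectory f a x J y \<and> t \<in> J \<and> y t \<in> S}"

definition min_time ::
  "('x::real_normed_vector \<Rightarrow> 'a::topological_space \<Rightarrow> 'x) \<Rightarrow> 'a set \<Rightarrow> 'x set \<Rightarrow> 'x \<Rightarrow> ereal" where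
  "min_time f A S x = (INF a\<in>controls A. hitting_time f S a x)"

definition reach_within ::
  "('x::real_normed_vector \<Rightarrow> 'a::topological_space \<Rightarrow> 'x) \<Rightarrow> 'a set \<Rightarrow> 'x set \<Rightarrow> real \<Rightarrow> 'x set" where
  "reach_within f A S t =
     {x. \<exists>a\<in>controls A. \<exists>J y s. trajectory f a x J y \<and> s \<in> J \<and> s < t \<and> y s \<in> S}"

definition STLA ::
  "('x::real_normed_vector \<Rightarrow> 'a::topological_space \<Rightarrow> 'x) \<Rightarrow> 'a set \<Rightarrow> 'x set \<Rightarrow> 'x \<Rightarrow> bool" where
  "STLA f A S xb \<longleftrightarrow> (\<forall>t>0. xb \<in> interior (reach_within f A S t))"

end

theory Submission
  imports Defs
begin

text \<open>
  If the supremum is positive, some pair \<open>(a\<^sub>1, a\<^sub>2)\<close> makes the expression positive. Write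
  \<open>f\<^sub>i = f(\<cdot>, a\<^sub>i)\<close> and \<open>g\<^sub>i = \<nabla>u \<cdot> f\<^sub>i\<close>, the rate of change of \<open>u\<close> along \<open>f\<^sub>i\<close>. Starting at \<open>x\<close>, follow
  \<open>f\<^sub>1\<close> for a time \<open>\<tau>\<close> and then \<open>f\<^sub>2\<close> for a time \<open>\<tau>\<close>. To second order \<open>u\<close> changes by
  \<open>\<tau> (g\<^sub>1 + g\<^sub>2)(x) + \<tau>\<^sup>2/2 Q\<close>, where
  \<open>Q = \<nabla>g\<^sub>1 \<cdot> f\<^sub>1 + \<nabla>g\<^sub>2 \<cdot> f\<^sub>2 + 2 \<nabla>g\<^sub>2 \<cdot> f\<^sub>1\<close> at \<open>xb\<close>; the factor 2 appears because \<open>g\<^sub>2\<close> has already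
  moved at the rate \<open>\<nabla>g\<^sub>2 \<cdot> f\<^sub>1\<close> during the whole first arc. Expanding the gradients with the symmetry
  of the Hessian shows that \<open>Q\<close> is the negative of the expression for \<open>(a\<^sub>1, a\<^sub>2)\<close>
  (\<open>second_variation_two_arcs\<close>), so \<open>Q < 0\<close>.

  Since the \<open>g\<^sub>i\<close> vanish at \<open>xb\<close>, both \<open>u(x) - u(xb)\<close> and \<open>(g\<^sub>1 + g\<^sub>2)(x)\<close> are at most a constant times
  \<open>d = |x - xb|\<close>. The final value of \<open>u\<close> therefore exceeds \<open>u(xb)\<close> by at most
  \<open>G\<^sub>1 d + \<tau> G\<^sub>2 d - \<kappa> \<tau>\<^sup>2\<close> with \<open>\<kappa> > 0\<close>, which is nonpositive for \<open>\<tau> = K \<surd>d\<close> with a suitable \<open>K\<close>: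
  this is the source of the exponent 1/2. The state then lies in the target at time \<open>2 K \<surd>d\<close>, which gives both
  claims (\<open>two_arcs_attain_in_sqrt_time\<close>).

  Only upper bounds are needed, so Taylor expansions are replaced by integrating differential
  inequalities (\<open>two_arc_upper_bound\<close>), with the second derivatives bounded on a ball by their
  values at \<open>xb\<close> up to a small error. The two arcs come from a Picard iteration that stays in that
  ball (\<open>lipschitz_flow_in_ball\<close>). As a trajectory is a \<^emph>\<open>maximal\<close> solution, the concatenated arcs have
  to be extended by Zorn's lemma (\<open>solution_extends_to_trajectory\<close>).
\<close>

section \<open>Differentiability from continuous partial derivatives\<close>


text \<open>A partial derivative is a derivative at parameter 0; translating the base point turns it into a derivative of the whole axis-parallel line, which is the form needed for mean value arguments.\<close>

lemma has_vector_derivative_along_axis: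
  assumes "\<And>z. has_partial j g z"
  shows "((\<lambda>s. g (x + s *\<^sub>R axis j 1)) has_vector_derivative partial j g (x + s *\<^sub>R axis j 1)) (at s)"
proof -
  have "((\<lambda>r. g ((x + s *\<^sub>R axis j 1) + r *\<^sub>R axis j 1)) has_vector_derivative
      partial j g (x + s *\<^sub>R axis j 1)) (at (s - s))"
    using assms[of "x + s *\<^sub>R axis j 1"] unfolding has_partial_def partial_def
    by (simp add: vector_derivative_works)
  moreover have "((\<lambda>r. r - s) has_vector_derivative 1) (at s)"
    by (auto intro!: derivative_eq_intros)
  ultimately show ?thesis
    using vector_diff_chain_at[of "\<lambda>r. r - s" 1 s
        "\<lambda>r. g ((x + s *\<^sub>R axis j 1) + r *\<^sub>R axis j 1)"]
    by (simp add: o_def algebra_simps)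
qed

text \<open>The classical criterion: pass from \<open>x\<close> to \<open>x + h\<close> by changing one coordinate at a time. Each step is
  a one-dimensional increment, along which the relevant partial derivative differs from its value at
  \<open>x\<close> by less than \<open>e'\<close>.\<close>

lemma has_derivative_of_continuous_partials:
  fixes g :: "real^'n::finite \<Rightarrow> 'b::real_normed_vector"
  assumes part: "\<And>j z. has_partial j g z"
    and cont: "\<And>j. isCont (partial j g) x"
  shows "(g has_derivative (\<lambda>h. \<Sum>j\<in>UNIV. h $ j *\<^sub>R partial j g x)) (at x)"
  unfolding has_derivative_at_alt
proof (intro conjI allI impI)
  show "bounded_linear (\<lambda>h. \<Sum>j\<in>UNIV. h $ j *\<^sub>R partial j g x)"
    by (intro bounded_linear_sum bounded_linear_scaleR_const bounded_linear_vec_nth)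
  fix e :: real assume "e > 0"
  define e' where "e' = e / CARD('n)"
  have "e' > 0" using \<open>e > 0\<close> by (simp add: e'_def)
  have "\<forall>\<^sub>F z in nhds x. \<forall>j. dist (partial j g z) (partial j g x) < e'"
    by (rule eventually_all_finite)
      (use cont \<open>e' > 0\<close> in \<open>auto simp: isCont_def tendsto_at_iff_tendsto_nhds dest: tendstoD\<close>)
  then obtain d where "d > 0"
    and d: "\<And>z j. dist z x < d \<Longrightarrow> norm (partial j g z - partial j g x) < e'"
    unfolding eventually_nhds_metric dist_norm by blast
  have "norm (g y - g x - (\<Sum>j\<in>UNIV. (y - x) $ j *\<^sub>R partial j g x)) \<le> e * norm (y - x)"
    if y: "norm (y - x) < d" for y
  proof -
    define h where "h = y - x"
    \<comment> \<open>The part of the displacement \<open>h\<close> whose coordinates in \<open>S\<close> have been changed.\<close>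
    define w where "w S = (\<Sum>j\<in>S. h $ j *\<^sub>R axis j (1::real))" for S :: "'n set"
    have w_nth: "w S $ i = (if i \<in> S then h $ i else 0)" if "finite S" for S i
      using that by (simp add: w_def axis_def if_distrib cong: if_cong)
    have "norm (g (x + w S) - g x - (\<Sum>j\<in>S. h $ j *\<^sub>R partial j g x)) \<le> (\<Sum>j\<in>S. \<bar>h $ j\<bar> * e')"
      if "finite S" for S
      using that
    proof (induction S rule: finite_induct)
      case empty
      then show ?case by (simp add: w_def)
    next
      case (insert k S)
      let ?z = "x + w S"
      have seg: "norm (partial k g (?z + s *\<^sub>R axis k 1) - partial k g x) \<le> e'"
        if "s \<in> closed_segment 0 (h $ k)" for s
      proof -
        \<comment> \<open>Every coordinate of the intermediate displacement is dominated by that of \<open>h\<close>, so it stays in the ball.\<close>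
        have "\<bar>s\<bar> \<le> \<bar>h $ k\<bar>" using that by (auto simp: closed_segment_eq_real_ivl split: if_splits)
        then have "norm (w S + s *\<^sub>R axis k 1) \<le> norm h"
          using insert.hyps
          by (intro norm_le_componentwise_cart) (auto simp: w_nth axis_def)
        then show ?thesis using d[of "?z + s *\<^sub>R axis k 1" k] y
          by (simp add: dist_norm h_def add.assoc)
      qed
      have "norm (g (?z + (h $ k) *\<^sub>R axis k 1) - g (?z + 0 *\<^sub>R axis k 1)
            - (h $ k - 0) *\<^sub>R partial k g x) \<le> norm (h $ k - 0) * e'"
      proof -
        let ?\<psi> = "\<lambda>s. g (?z + s *\<^sub>R axis k 1) - s *\<^sub>R partial k g x"
        let ?\<psi>' = "\<lambda>s. partial k g (?z + s *\<^sub>R axis k 1) - partial k g x"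
        have "((\<lambda>s. s *\<^sub>R partial k g x) has_vector_derivative partial k g x) (at s)" for s
          unfolding has_vector_derivative_def
          by (rule bounded_linear_imp_has_derivative[OF bounded_linear_scaleR_left])
        then have \<psi>: "(?\<psi> has_vector_derivative ?\<psi>' s) (at s within closed_segment 0 (h $ k))" for s
          by (rule has_vector_derivative_at_within[OF has_vector_derivative_diff[OF
                has_vector_derivative_along_axis[OF part]]])
        have "norm (?\<psi> (h $ k) - ?\<psi> 0) \<le> e' * norm (h $ k - 0)"
        proof (rule differentiable_bound[where S = "closed_segment 0 (h $ k)" and
              f' = "\<lambda>s r. r *\<^sub>R ?\<psi>' s"])
          show "(?\<psi> has_derivative (\<lambda>r. r *\<^sub>R ?\<psi>' s)) (at s within closed_segment 0 (h $ k))" for s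
            using \<psi>[of s] by (simp only: has_vector_derivative_def)
          show "onorm (\<lambda>r. r *\<^sub>R ?\<psi>' s) \<le> e'" if "s \<in> closed_segment 0 (h $ k)" for s
            by (rule onorm_le) (use mult_right_mono[OF seg[OF that] abs_ge_zero] in \<open>simp add: mult.commute\<close>)
        qed auto
        then show ?thesis by (simp add: algebra_simps)
      qed
      then have "norm ((g (?z + (h $ k) *\<^sub>R axis k 1) - g ?z - h $ k *\<^sub>R partial k g x)
          + (g ?z - g x - (\<Sum>j\<in>S. h $ j *\<^sub>R partial j g x)))
          \<le> \<bar>h $ k\<bar> * e' + (\<Sum>j\<in>S. \<bar>h $ j\<bar> * e')"
        using insert.IH by (intro norm_triangle_mono) auto
      moreover have "w (insert k S) = w S + (h $ k) *\<^sub>R axis k 1"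
        using insert.hyps by (simp add: w_def)
      ultimately show ?case using insert.hyps by (simp add: algebra_simps)
    qed
    from this[of UNIV] have "norm (g (x + w UNIV) - g x - (\<Sum>j\<in>UNIV. h $ j *\<^sub>R partial j g x))
        \<le> (\<Sum>j\<in>UNIV. \<bar>h $ j\<bar> * e')" by simp
    also have "x + w UNIV = y" by (simp add: vec_eq_iff w_nth h_def)
    also have "(\<Sum>j\<in>UNIV. \<bar>h $ j\<bar> * e') \<le> (\<Sum>j\<in>(UNIV::'n set). norm h * e')"
      using \<open>e' > 0\<close> by (intro sum_mono mult_right_mono component_le_norm_cart) auto
    also have "\<dots> = e * norm h" by (simp add: e'_def)
    finally show ?thesis by (simp add: h_def)
  qed
  with \<open>d > 0\<close> show "\<exists>d>0. \<forall>y. norm (y - x) < d \<longrightarrow>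
      norm (g y - g x - (\<Sum>j\<in>UNIV. (y - x) $ j *\<^sub>R partial j g x)) \<le> e * norm (y - x)"
    by blast
qed

text \<open>Two mean value steps, first in direction \<open>j\<close> and then in direction \<open>i\<close>. The left-hand side is symmetric
  in \<open>i\<close> and \<open>j\<close>, the right-hand side is not; this is what forces mixed partials to agree.\<close>

lemma second_difference_quotient:
  fixes u :: "real^'n::finite \<Rightarrow> real"
  assumes pj: "\<And>z. has_partial j u z" and pij: "\<And>z. has_partial i (partial j u) z" and "s > 0"
  shows "\<exists>z. dist z x \<le> 2 * s \<and>
    u (x + s *\<^sub>R axis j 1 + s *\<^sub>R axis i 1) - u (x + s *\<^sub>R axis j 1) - u (x + s *\<^sub>R axis i 1) + u x
      = s\<^sup>2 * partial i (partial j u) z"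
proof -
  let ?\<phi> = "\<lambda>r. u (x + s *\<^sub>R axis i 1 + r *\<^sub>R axis j 1) - u (x + r *\<^sub>R axis j 1)"
  have "DERIV ?\<phi> r :> partial j u (x + s *\<^sub>R axis i 1 + r *\<^sub>R axis j 1) - partial j u (x + r *\<^sub>R axis j 1)" for r
    using has_vector_derivative_along_axis[of j u, OF pj]
    by (auto intro!: derivative_intros simp: has_real_derivative_iff_has_vector_derivative)
  from MVT2[OF \<open>s > 0\<close> this] obtain \<rho> where \<rho>: "0 < \<rho>" "\<rho> < s"
    and e1: "?\<phi> s - ?\<phi> 0 = s * (partial j u (x + s *\<^sub>R axis i 1 + \<rho> *\<^sub>R axis j 1) - partial j u (x + \<rho> *\<^sub>R axis j 1))"
    by auto
  let ?\<chi> = "\<lambda>r. partial j u (x + \<rho> *\<^sub>R axis j 1 + r *\<^sub>R axis i 1)"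
  have "DERIV ?\<chi> r :> partial i (partial j u) (x + \<rho> *\<^sub>R axis j 1 + r *\<^sub>R axis i 1)" for r
    using has_vector_derivative_along_axis[of i "partial j u", OF pij]
    by (auto simp: has_real_derivative_iff_has_vector_derivative)
  from MVT2[OF \<open>s > 0\<close> this] obtain \<sigma> where \<sigma>: "0 < \<sigma>" "\<sigma> < s"
    and e2: "?\<chi> s - ?\<chi> 0 = s * partial i (partial j u) (x + \<rho> *\<^sub>R axis j 1 + \<sigma> *\<^sub>R axis i 1)"
    by auto
  let ?z = "x + \<rho> *\<^sub>R axis j 1 + \<sigma> *\<^sub>R axis i 1"
  have "norm (\<rho> *\<^sub>R axis j (1::real) + \<sigma> *\<^sub>R axis i 1) \<le> \<rho> + \<sigma>"
    using norm_triangle_ineq[of "\<rho> *\<^sub>R axis j (1::real)" "\<sigma> *\<^sub>R axis i 1"] \<rho> \<sigma> by simp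
  then have "dist ?z x \<le> 2 * s" using \<rho> \<sigma> by (simp add: dist_norm add.assoc)
  moreover have "u (x + s *\<^sub>R axis j 1 + s *\<^sub>R axis i 1) - u (x + s *\<^sub>R axis j 1) - u (x + s *\<^sub>R axis i 1) + u x
      = s\<^sup>2 * partial i (partial j u) ?z"
    using e1 e2 by (simp add: algebra_simps power2_eq_square)
  ultimately show ?thesis by blast
qed

lemma partial_commute:
  fixes u :: "real^'n::finite \<Rightarrow> real"
  assumes p: "\<And>j z. has_partial j u z" and pp: "\<And>i j z. has_partial i (partial j u) z"
    and cont: "\<And>i j. isCont (partial i (partial j u)) x"
  shows "partial i (partial j u) x = partial j (partial i u) x"
proof -
  define \<Delta> where "\<Delta> i j s = (u (x + s *\<^sub>R axis j 1 + s *\<^sub>R axis i 1) - u (x + s *\<^sub>R axis j 1)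
      - u (x + s *\<^sub>R axis i 1) + u x) / s\<^sup>2" for i j s
  have lim: "(\<Delta> i j \<longlongrightarrow> partial i (partial j u) x) (at_right 0)" for i j
  proof (rule tendstoI)
    fix e :: real assume "e > 0"
    then obtain d where "d > 0"
      and d: "\<And>z. dist z x < d \<Longrightarrow> dist (partial i (partial j u) z) (partial i (partial j u) x) < e"
      using cont[of i j] unfolding continuous_at_eps_delta by blast
    have "dist (\<Delta> i j s) (partial i (partial j u) x) < e" if "0 < s" "s < d / 2" for s
    proof -
      obtain z where "dist z x \<le> 2 * s" "\<Delta> i j s = partial i (partial j u) z"
        using second_difference_quotient[of j u i s x, OF p pp \<open>0 < s\<close>] \<open>0 < s\<close>
        by (auto simp: \<Delta>_def)
      then show ?thesis using d[of z] that by simp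
    qed
    then show "\<forall>\<^sub>F s in at_right 0. dist (\<Delta> i j s) (partial i (partial j u) x) < e"
      unfolding eventually_at_right_field using \<open>d > 0\<close> by (intro exI[of _ "d / 2"]) auto
  qed
  have "\<Delta> i j = \<Delta> j i" by (simp add: \<Delta>_def fun_eq_iff algebra_simps)
  then show ?thesis using tendsto_unique[OF _ lim[of i j]] lim[of j i] by simp
qed

text \<open>Lists of indices grow at the outermost derivative; for induction on the smoothness degree the
  innermost derivative has to be split off instead.\<close>

lemma iterated_partial_snoc: "iterated_partial (js @ [j]) g = iterated_partial js (partial j g)"
  by (induction js) auto

lemma class_C_mono: "class_C k g \<Longrightarrow> l \<le> k \<Longrightarrow> class_C l g"
  unfolding class_C_def has_partials_upto_def by (meson le_trans less_le_trans)

lemma class_C_continuous: "class_C k g \<Longrightarrow> isCont g x"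
  unfolding class_C_def using continuous_on_eq_continuous_at[OF open_UNIV, of g]
  by (metis UNIV_I iterated_partial.simps(1) le0 list.size(3))

lemma class_C_has_partial: "class_C (Suc k) g \<Longrightarrow> has_partial j g x"
  unfolding class_C_def has_partials_upto_def
  by (metis iterated_partial.simps(1) list.size(3) zero_less_Suc)

lemma class_C_partial:
  assumes "class_C (Suc k) g" shows "class_C k (partial j g)"
  unfolding class_C_def has_partials_upto_def
proof (intro conjI allI impI)
  fix js :: "'a list" and i x assume "length js < k"
  then have "length (js @ [j]) < Suc k" by simp
  then show "has_partial i (iterated_partial js (partial j g)) x"
    using assms unfolding class_C_def has_partials_upto_def
    by (metis iterated_partial_snoc)
next
  fix js :: "'a list" assume "length js \<le> k"
  then have "length (js @ [j]) \<le> Suc k" by simp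
  then show "continuous_on UNIV (iterated_partial js (partial j g))"
    using assms unfolding class_C_def by (metis iterated_partial_snoc)
qed

lemma spatial_class_C_imp_class_C:
  assumes "spatial_class_C k A f" "a \<in> A"
  shows "class_C k (\<lambda>x. f x a)"
proof -
  have "continuous_on UNIV (iterated_partial js (\<lambda>y. f y a))" if "length js \<le> k" for js
  proof -
    have "continuous_on (UNIV \<times> A) (\<lambda>(x, a). iterated_partial js (\<lambda>y. f y a) x)"
      using assms that by (auto simp: spatial_class_C_def)
    then have "continuous_on UNIV ((\<lambda>(x, a). iterated_partial js (\<lambda>y. f y a) x) \<circ> (\<lambda>x. (x, a)))"
      by (rule continuous_on_compose2[folded o_def]) (use assms in \<open>auto intro!: continuous_intros\<close>)
    then show ?thesis by (simp add: o_def)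
  qed
  then show ?thesis using assms by (auto simp: spatial_class_C_def class_C_def)
qed

lemma partial_nth:
  fixes g :: "real^'n::finite \<Rightarrow> real^'k::finite"
  assumes "has_partial j g x"
  shows "partial j (\<lambda>y. g y $ i) x = partial j g x $ i"
  using assms unfolding has_partial_def partial_def
  by (intro vector_derivative_at bounded_linear.has_vector_derivative[OF bounded_linear_vec_nth])
    (simp add: vector_derivative_works)

lemma partial_add:
  assumes "has_partial j g x" "has_partial j h x"
  shows "partial j (\<lambda>y. g y + h y) x = partial j g x + partial j h x"
  using assms unfolding has_partial_def partial_def
  by (intro vector_derivative_at has_vector_derivative_add) (simp_all add: vector_derivative_works)

lemma has_derivative_grad:
  assumes "class_C 1 u"
  shows "(u has_derivative (\<lambda>h. grad u x \<bullet> h)) (at x)"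
proof -
  have "(u has_derivative (\<lambda>h. \<Sum>j\<in>UNIV. h $ j *\<^sub>R partial j u x)) (at x)"
    using assms class_C_has_partial[of 0 u] class_C_continuous[OF class_C_partial[of 0 u]]
    by (intro has_derivative_of_continuous_partials) auto
  then show ?thesis by (simp add: grad_def inner_vec_def mult.commute)
qed

lemma jac_nth:
  assumes "class_C 1 g" shows "jac g x $ i $ j = partial j g x $ i"
  using assms class_C_has_partial[of 0 g] by (simp add: jac_def partial_nth)

lemma has_derivative_jac:
  assumes "class_C 1 g"
  shows "(g has_derivative (\<lambda>h. jac g x *v h)) (at x)"
proof -
  have "(g has_derivative (\<lambda>h. \<Sum>j\<in>UNIV. h $ j *\<^sub>R partial j g x)) (at x)"
    using assms class_C_has_partial[of 0 g] class_C_continuous[OF class_C_partial[of 0 g]]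
    by (intro has_derivative_of_continuous_partials) auto
  moreover have "jac g x *v h = (\<Sum>j\<in>UNIV. h $ j *\<^sub>R partial j g x)" for h
    by (simp add: vec_eq_iff matrix_vector_mult_def jac_nth[OF assms] mult.commute)
  ultimately show ?thesis by simp
qed

lemma isCont_jac:
  assumes "class_C 1 g" shows "isCont (jac g) x"
proof -
  have "isCont (\<lambda>x. partial j g x $ i) x" for i j
    using assms class_C_continuous[OF class_C_partial[of 0 g]] by simp
  then show ?thesis unfolding isCont_def
    by (intro vec_tendstoI) (simp add: jac_nth[OF assms])
qed

lemma jac_add:
  assumes "class_C 1 g" "class_C 1 h"
  shows "jac (\<lambda>x. g x + h x) x = jac g x + jac h x"
proof -
  have p: "has_partial j g x" "has_partial j h x" for j
    using assms class_C_has_partial[of 0] by auto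
  then have "has_partial j (\<lambda>x. g x + h x) x" for j
    unfolding has_partial_def by (intro differentiable_add)
  then have "jac (\<lambda>x. g x + h x) x $ i $ j = partial j (\<lambda>x. g x + h x) x $ i" for i j
    unfolding jac_def vec_lambda_beta by (rule partial_nth)
  then show ?thesis using p assms by (simp add: vec_eq_iff jac_nth partial_add)
qed

text \<open>Schwarz' theorem. It is needed because the criterion contains the sum of the two mixed terms
  \<open>D\<^sup>2u f\<^sub>1 \<cdot> f\<^sub>2\<close> and \<open>D\<^sup>2u f\<^sub>2 \<cdot> f\<^sub>1\<close>, whereas the two-arc motion produces one of them twice.\<close>

lemma hessian_symmetric:
  assumes "class_C 2 u" shows "hessian u x $ i $ j = hessian u x $ j $ i"
proof -
  have 2: "class_C (Suc (Suc 0)) u" using assms by (simp add: numeral_2_eq_2)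
  have "has_partial j u z" "has_partial i (partial j u) z" "isCont (partial i (partial j u)) z"
    for i j z
    using 2 class_C_has_partial class_C_partial class_C_continuous by blast+
  then have "partial i (partial j u) x = partial j (partial i u) x"
    by (rule partial_commute)
  then show ?thesis by (simp add: hessian_def)
qed

lemma has_derivative_hessian:
  assumes "class_C 2 u"
  shows "(grad u has_derivative (\<lambda>h. hessian u x *v h)) (at x)"
  unfolding has_derivative_componentwise_within[of "grad u"]
proof
  fix b :: "real^'a" assume "b \<in> Basis"
  then obtain i where b: "b = axis i 1" by (auto simp: Basis_vec_def)
  have "class_C 1 (partial i u)" using assms class_C_partial[of 1 u] by (simp add: numeral_2_eq_2)
  then have "(partial i u has_derivative (\<lambda>h. grad (partial i u) x \<bullet> h)) (at x)"
    by (rule has_derivative_grad)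
  moreover have "grad (partial i u) x \<bullet> h = (hessian u x *v h) $ i" for h
    by (simp add: inner_vec_def matrix_vector_mult_def hessian_symmetric[OF assms, of x i])
      (simp add: grad_def hessian_def)
  ultimately show "((\<lambda>y. grad u y \<bullet> b) has_derivative (\<lambda>h. (hessian u x *v h) \<bullet> b)) (at x)"
    by (simp add: b inner_axis) (simp add: grad_def)
qed

lemma isCont_hessian:
  assumes "class_C 2 u" shows "isCont (hessian u) x"
proof -
  have "class_C (Suc (Suc 0)) u" using assms by (simp add: numeral_2_eq_2)
  then have "isCont (partial i (partial j u)) x" for i j
    using class_C_partial class_C_continuous by blast
  then show ?thesis unfolding isCont_def
    by (intro vec_tendstoI) (simp add: hessian_def)
qed


section \<open>Arcs, their concatenation, and maximal extension\<close>

text \<open>Picard's theorem on a ball where the field is Lipschitz: the bound on \<open>\<tau>\<close> keeps the iterates in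
  that ball. The Banach fixed point theorem is applied to
  bounded continuous functions on all of \<open>\<real>\<close>, with time clamped to \<open>{0..\<tau>}\<close> by \<open>cl\<close>.\<close>

lemma lipschitz_flow_in_ball:
  fixes g :: "'b::euclidean_space \<Rightarrow> 'b"
  assumes lip: "\<And>x y. x \<in> cball c R \<Longrightarrow> y \<in> cball c R \<Longrightarrow> norm (g x - g y) \<le> L * norm (x - y)"
    and bd: "\<And>x. x \<in> cball c R \<Longrightarrow> norm (g x) \<le> M"
    and \<tau>: "0 \<le> \<tau>" "L * \<tau> < 1" and L: "0 \<le> L" and 0: "0 \<le> M" and x: "norm (x - c) + M * \<tau> \<le> R"
  shows "\<exists>y. y 0 = x \<and> (\<forall>t\<in>{0..\<tau>}. norm (y t - x) \<le> M * \<tau> \<and>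
    (y has_vector_derivative g (y t)) (at t within {0..\<tau>}))"
proof -
  define S where "S = PiC (UNIV::real set) (\<lambda>_. cball c R)"
  define cl :: "real \<Rightarrow> real" where "cl t = max 0 (min t \<tau>)" for t
  define P where "P y t = x + integral {0..cl t} (\<lambda>s. g (y s))" for y :: "real \<Rightarrow> 'b" and t
  have cl: "cl t \<in> {0..\<tau>}" for t using \<tau> by (auto simp: cl_def)
  have contg: "continuous_on (cball c R) g"
  proof (rule lipschitz_on_continuous_on)
    show "L-lipschitz_on (cball c R) g"
      using lip L by (auto intro!: lipschitz_onI simp: dist_norm)
  qed
  have in_ball: "y s \<in> cball c R" if "y \<in> S" for y :: "real \<Rightarrow>\<^sub>C 'b" and s
    using that by (auto simp: S_def mem_PiC_iff)
  have contgy: "continuous_on T (\<lambda>s. g (y s))" if "y \<in> S" for y :: "real \<Rightarrow>\<^sub>C 'b" and T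
    using in_ball[OF that] by (intro continuous_on_compose2[OF contg]) auto
  have int: "(\<lambda>s. g (y s)) integrable_on {a..b}" if "y \<in> S" for y :: "real \<Rightarrow>\<^sub>C 'b" and a b
    by (intro integrable_continuous_real contgy that)
  have near: "norm (P y t - x) \<le> M * \<tau>" if "y \<in> S" for y :: "real \<Rightarrow>\<^sub>C 'b" and t
  proof -
    have "norm (P y t - x) \<le> M * (cl t - 0)"
      using cl[of t] bd in_ball[OF that] unfolding P_def
      by (simp, intro order_trans[OF integral_bound[where B = M]]) (auto intro: contgy[OF that])
    also have "\<dots> \<le> M * \<tau>" using cl[of t] 0 by (auto intro: mult_left_mono)
    finally show ?thesis .
  qed
  have Pball: "P y t \<in> cball c R" if "y \<in> S" for y :: "real \<Rightarrow>\<^sub>C 'b" and t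
    using near[OF that, of t] x norm_triangle_ineq[of "P y t - x" "x - c"]
    by (simp add: dist_norm norm_minus_commute)
  have Pcont: "continuous_on UNIV (P y)" if "y \<in> S" for y :: "real \<Rightarrow>\<^sub>C 'b"
  proof -
    have "continuous_on {0..\<tau>} (\<lambda>t. integral {0..t} (\<lambda>s. g (y s)))"
      by (rule indefinite_integral_continuous_1) (rule int[OF that])
    moreover have "continuous_on UNIV cl" unfolding cl_def by (intro continuous_intros)
    ultimately have "continuous_on UNIV (\<lambda>t. integral {0..cl t} (\<lambda>s. g (y s)))"
      using cl by (rule continuous_on_compose2[where f = cl, OF _ _ image_subsetI])
    then show ?thesis unfolding P_def by (rule continuous_on_add[OF continuous_on_const])
  qed
  define \<Phi> where "\<Phi> y = Bcontfun (P (apply_bcontfun y))" for y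
  have \<Phi>: "apply_bcontfun (\<Phi> y) = P y" if "y \<in> S" for y
  proof -
    have "bounded (range (P y))"
      using Pball[OF that] by (intro bounded_subset[OF bounded_cball]) auto
    then show ?thesis using Pcont[OF that] by (simp add: \<Phi>_def Bcontfun_inverse bcontfun_def)
  qed
  have "\<exists>!y\<in>S. \<Phi> y = y"
  proof (rule Banach_fix)
    show "complete S"
      unfolding S_def complete_eq_closed by (intro closed_PiC) auto
    have "0 \<le> M * \<tau>" using 0 \<tau> by simp
    then have "x \<in> cball c R" using x by (simp add: dist_norm norm_minus_commute del: zero_le_mult_iff)
    then have "const_bcontfun x \<in> S" by (auto simp: S_def mem_PiC_iff const_bcontfun.rep_eq)
    then show "S \<noteq> {}" by blast
    show "0 \<le> L * \<tau>" "L * \<tau> < 1" using L \<tau> by auto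
    have "\<Phi> y \<in> S" if "y \<in> S" for y
      unfolding S_def by (rule mem_PiCI) (use Pball[OF that] \<Phi>[OF that] in auto)
    then show "\<Phi> ` S \<subseteq> S" by blast
    show "dist (\<Phi> y) (\<Phi> z) \<le> L * \<tau> * dist y z" if "y \<in> S" "z \<in> S" for y z
    proof (rule dist_bound)
      fix t
      have "dist (\<Phi> y t) (\<Phi> z t) = norm (integral {0..cl t} (\<lambda>s. g (y s) - g (z s)))"
        by (simp add: \<Phi> that P_def dist_norm int Henstock_Kurzweil_Integration.integral_diff)
      also have "\<dots> \<le> L * dist y z * (cl t - 0)"
      proof (rule integral_bound)
        show "0 \<le> cl t" using cl[of t] by simp
        show "continuous_on {0..cl t} (\<lambda>s. g (y s) - g (z s))"
          by (intro continuous_intros contgy that)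
        fix s
        have "norm (g (y s) - g (z s)) \<le> L * dist (y s) (z s)"
          using lip[OF in_ball in_ball] that by (simp add: dist_norm)
        also have "\<dots> \<le> L * dist y z" by (intro mult_left_mono dist_bounded L)
        finally show "norm (g (y s) - g (z s)) \<le> L * dist y z" .
      qed
      also have "\<dots> \<le> L * dist y z * \<tau>" using cl[of t] L by (intro mult_left_mono) auto
      finally show "dist (\<Phi> y t) (\<Phi> z t) \<le> L * \<tau> * dist y z" by (simp add: mult_ac)
    qed
  qed
  then obtain y where y: "y \<in> S" "\<Phi> y = y" by blast
  then have yP: "y t = P y t" for t using \<Phi> by metis
  show ?thesis
  proof (intro exI[of _ "apply_bcontfun y"] conjI ballI)
    have "cl 0 = 0" using \<tau> by (simp add: cl_def)
    then show "y 0 = x" using yP[of 0] by (simp add: P_def)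
    show "norm (y t - x) \<le> M * \<tau>" for t using near[OF y(1), of t] yP[of t] by simp
    fix t assume t: "t \<in> {0..\<tau>}"
    have "((\<lambda>t. x + integral {0..t} (\<lambda>s. g (y s))) has_vector_derivative 0 + g (y t)) (at t within {0..\<tau>})"
      by (intro has_vector_derivative_add has_vector_derivative_const
          integral_has_vector_derivative contgy y t)
    then have "((\<lambda>t. x + integral {0..t} (\<lambda>s. g (y s))) has_vector_derivative g (y t)) (at t within {0..\<tau>})"
      by simp
    then show "(y has_vector_derivative g (y t)) (at t within {0..\<tau>})"
    proof (rule has_vector_derivative_transform[OF t, rotated])
      fix s assume "s \<in> {0..\<tau>}"
      then have "cl s = s" by (auto simp: cl_def)
      then show "y s = x + integral {0..s} (\<lambda>s. g (y s))"
        using yP[of s] by (simp add: P_def)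
    qed
  qed
qed

text \<open>At the switching time the equation has to hold only if the control is continuous there. For
  \<open>\<tau> > 0\<close> this means \<open>a1 = a2\<close>, and then the one-sided derivatives of the two arcs agree.\<close>

lemma solution_on_concat:
  fixes f :: "'x::real_normed_vector \<Rightarrow> 'a::t2_space \<Rightarrow> 'x"
  assumes "0 \<le> \<tau>" "0 \<le> \<sigma>" and y0: "y1 0 = x" "y2 0 = y1 \<tau>"
    and y1: "\<And>t. t \<in> {0..\<tau>} \<Longrightarrow> (y1 has_vector_derivative f (y1 t) a1) (at t within {0..\<tau>})"
    and y2: "\<And>t. t \<in> {0..\<sigma>} \<Longrightarrow> (y2 has_vector_derivative f (y2 t) a2) (at t within {0..\<sigma>})"
  shows "solution_on f (\<lambda>s. if s < \<tau> then a1 else a2) x {0..\<tau> + \<sigma>}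
    (\<lambda>s. if s \<le> \<tau> then y1 s else y2 (s - \<tau>))"
proof -
  let ?a = "\<lambda>s. if s < \<tau> then a1 else a2"
  let ?y2 = "\<lambda>s. y2 (s - \<tau>)"
  let ?y = "\<lambda>s. if s \<le> \<tau> then y1 s else ?y2 s"
  have y2': "(?y2 has_vector_derivative f (?y2 t) a2) (at t within {\<tau>..\<tau> + \<sigma>})"
    if "t \<in> {\<tau>..\<tau> + \<sigma>}" for t
  proof -
    have "((\<lambda>s. s - \<tau>) has_vector_derivative 1) (at t within {\<tau>..\<tau> + \<sigma>})"
      by (auto intro!: derivative_eq_intros)
    moreover have "(\<lambda>s. s - \<tau>) ` {\<tau>..\<tau> + \<sigma>} = {0..\<sigma>}"
      using image_add_atLeastAtMost[of "-\<tau>" \<tau> "\<tau> + \<sigma>"] by simp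
    ultimately show ?thesis
      using vector_diff_chain_within[of "\<lambda>s. s - \<tau>" 1 t "{\<tau>..\<tau> + \<sigma>}" y2 "f (y2 (t - \<tau>)) a2"]
        y2[of "t - \<tau>"] that by (simp add: o_def)
  qed
  have union: "{0..\<tau> + \<sigma>} = {0..\<tau>} \<union> {\<tau>..\<tau> + \<sigma>}" using assms by auto
  have left: "(?y has_vector_derivative f (?y t) a1) (at t within {0..\<tau>})" if "t \<in> {0..\<tau>}" for t
    using that has_vector_derivative_transform[OF that, of ?y y1 "f (y1 t) a1"] y1[OF that] by simp
  have right: "(?y has_vector_derivative f (?y t) a2) (at t within {\<tau>..\<tau> + \<sigma>})"
    if "t \<in> {\<tau>..\<tau> + \<sigma>}" for t
  proof -
    have "?y s = ?y2 s" if "s \<in> {\<tau>..\<tau> + \<sigma>}" for s using that y0 by auto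
    then show ?thesis
      using y2'[OF that] that has_vector_derivative_transform[OF that, of ?y ?y2 "f (?y2 t) a2"] by simp
  qed
  have cont: "continuous_on {0..\<tau> + \<sigma>} ?y"
    unfolding union
    by (intro continuous_on_closed_Un)
      (auto simp: continuous_on_eq_continuous_within
        intro: has_vector_derivative_continuous[OF left] has_vector_derivative_continuous[OF right])
  have der: "(?y has_vector_derivative f (?y t) (?a t)) (at t within {0..\<tau> + \<sigma>})"
    if t: "t \<in> {0..\<tau> + \<sigma>}" and ca: "continuous (at t within {0..}) ?a" for t
  proof -
    consider "t < \<tau>" | "t > \<tau>" | "t = \<tau>" by linarith
    then show ?thesis
    proof cases
      case 1
      then have "at t within {0..\<tau> + \<sigma>} = at t within {0..\<tau>}"
        using assms t by (intro at_within_nhd[of _ "{..<\<tau>}"]) auto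
      then show ?thesis using left[of t] 1 t by simp
    next
      case 2
      then have "at t within {0..\<tau> + \<sigma>} = at t within {\<tau>..\<tau> + \<sigma>}"
        using assms t by (intro at_within_nhd[of _ "{\<tau><..}"]) auto
      then show ?thesis using right[of t] 2 t by simp
    next
      case 3
      show ?thesis
      proof (cases "0 < \<tau> \<and> a1 \<noteq> a2")
        case True
        have "(?a \<longlongrightarrow> ?a t) (at t within {0..})" using ca by (simp add: continuous_within)
        then have "(?a \<longlongrightarrow> a2) (at t within {0..<\<tau>})"
          using 3 by (auto dest: tendsto_within_subset[of _ _ _ _ "{0..<\<tau>}"])
        moreover have "(?a \<longlongrightarrow> a1) (at t within {0..<\<tau>})"
          by (rule tendsto_eventually) (auto simp: eventually_at_filter)
        moreover have "at t within {0..<\<tau>} \<noteq> bot"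
          using True 3 by (simp add: trivial_limit_within islimpt_Ico)
        ultimately have "a1 = a2" using tendsto_unique by blast
        then show ?thesis using True by blast
      next
        case False
        then have "a1 = a2 \<or> \<tau> = 0" using \<open>0 \<le> \<tau>\<close> by auto
        then show ?thesis
        proof
          assume "\<tau> = 0"
          then show ?thesis using right[of t] 3 t by simp
        next
          assume "a1 = a2"
          then show ?thesis using left[of t] right[of t] 3 assms
            unfolding union has_vector_derivative_def has_derivative_within Lim_within_Un by auto
        qed
      qed
    qed
  qed
  show ?thesis
    unfolding solution_on_def using assms cont der by (auto simp: is_interval_cc)
qed


text \<open>Zorn's lemma, applied to the graphs of the solutions that extend the given one, ordered by inclusion.
  A union of a chain is again a solution because near any of its times \<open>t\<close> it coincides with a single member
  of the chain: one that reaches beyond \<open>t\<close> if there is one, and otherwise, when \<open>t\<close> is the last time,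
  any member that is defined at \<open>t\<close>.\<close>

lemma solution_extends_to_trajectory:
  assumes sol: "solution_on f a x J y"
  shows "\<exists>J' y'. trajectory f a x J' y' \<and> J \<subseteq> J' \<and> (\<forall>t\<in>J. y' t = y t)"
proof -
  define graph where "graph I z = (\<lambda>t. (t, z t)) ` I" for I :: "real set" and z :: "real \<Rightarrow> 'a"
  define \<A> where "\<A> = {graph I z | I z. solution_on f a x I z \<and> graph J y \<subseteq> graph I z}"
  have sub: "graph I z \<subseteq> graph I' z' \<longleftrightarrow> I \<subseteq> I' \<and> (\<forall>t\<in>I. z' t = z t)" for I I' z z'
    by (auto simp: graph_def)
  have "\<Union>\<C> \<in> \<A>" if ne: "\<C> \<noteq> {}" and chain: "subset.chain \<A> \<C>" for \<C>
  proof -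
    define K where "K = Domain (\<Union>\<C>)"
    define w where "w t = (SOME v. (t, v) \<in> \<Union>\<C>)" for t
    have mem: "\<exists>I z. X = graph I z \<and> solution_on f a x I z \<and> graph J y \<subseteq> graph I z" if "X \<in> \<C>" for X
      using that chain unfolding subset.chain_def \<A>_def by blast
    have single: "v = v'" if "(t, v) \<in> X" "(t, v') \<in> X'" "X \<in> \<C>" "X' \<in> \<C>" for t v v' X X'
    proof -
      have "X \<subseteq> X' \<or> X' \<subseteq> X" using chain that unfolding subset.chain_def by blast
      then have "\<exists>Y\<in>\<C>. (t, v) \<in> Y \<and> (t, v') \<in> Y" using that by blast
      then show ?thesis using mem by (fastforce simp: graph_def)
    qed
    have w: "w t = v" if "(t, v) \<in> X" "X \<in> \<C>" for t v X
      unfolding w_def using single that by (intro some_equality) blast+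
    have "\<Union>\<C> = graph K w"
    proof (intro set_eqI iffI)
      fix q assume "q \<in> \<Union>\<C>"
      then obtain t v X where q: "q = (t, v)" "(t, v) \<in> X" "X \<in> \<C>" by (cases q) blast
      then have "w t = v" "t \<in> K" using w unfolding K_def by blast+
      then show "q \<in> graph K w" using q by (auto simp: graph_def)
    next
      fix q assume "q \<in> graph K w"
      then obtain t where t: "q = (t, w t)" "t \<in> Domain (\<Union>\<C>)" by (auto simp: graph_def K_def)
      from t(2) obtain v X where "(t, v) \<in> X" "X \<in> \<C>" by blast
      then show "q \<in> \<Union>\<C>" using w t(1) by auto
    qed
    have cover: "\<exists>I z. solution_on f a x I z \<and> t \<in> I \<and> I \<subseteq> K \<and> (\<forall>s\<in>I. w s = z s)" if t: "t \<in> K" for t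
    proof -
      obtain X v where X: "X \<in> \<C>" "(t, v) \<in> X" using t unfolding K_def by blast
      then obtain I z where "X = graph I z" "solution_on f a x I z" using mem by blast
      moreover have "graph I z \<subseteq> graph K w" using X \<open>X = graph I z\<close> \<open>\<Union>\<C> = graph K w\<close> by blast
      ultimately show ?thesis using X unfolding sub by (auto simp: graph_def)
    qed
    have down: "{0..b} \<subseteq> I" if "solution_on f a x I z" "b \<in> I" for I z b
      using that unfolding solution_on_def is_interval_1 by (meson atLeastAtMost_iff subsetI)
    have local: "\<exists>I z. solution_on f a x I z \<and> t \<in> I \<and> I \<subseteq> K \<and> (\<forall>s\<in>I. w s = z s) \<and>
        at t within K = at t within I" if t: "t \<in> K" for t
    proof (cases "\<exists>b\<in>K. t < b")
      case True
      then obtain b where b: "b \<in> K" "t < b" by blast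
      obtain I z where I: "solution_on f a x I z" "b \<in> I" "I \<subseteq> K" "\<forall>s\<in>I. w s = z s"
        using cover[OF b(1)] by blast
      have "0 \<le> s" if "s \<in> K" for s
        using cover[OF that] unfolding solution_on_def by auto
      then have sub_b: "K \<inter> {..<b} \<subseteq> I" "t \<in> I" using down[OF I(1,2)] t b by force+
      then have "at t within K = at t within I"
        using I b by (intro at_within_nhd[of _ "{..<b}"]) auto
      then show ?thesis using I sub_b by blast
    next
      case False
      obtain I z where I: "solution_on f a x I z" "t \<in> I" "I \<subseteq> K" "\<forall>s\<in>I. w s = z s"
        using cover[OF t] by blast
      have "0 \<le> s" if "s \<in> K" for s
        using cover[OF that] unfolding solution_on_def by auto
      then have "K \<subseteq> I" using down[OF I(1,2)] False by force
      then have "K = I" using I by blast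
      then show ?thesis using I by blast
    qed
    obtain X0 where "X0 \<in> \<C>" using ne by blast
    then obtain I0 z0 where X0: "X0 = graph I0 z0" "solution_on f a x I0 z0" "graph J y \<subseteq> X0"
      using mem by blast
    have "graph J y \<subseteq> graph K w" using \<open>X0 \<in> \<C>\<close> X0 \<open>\<Union>\<C> = graph K w\<close> by blast
    have "(0, x) \<in> X0" using X0 by (force simp: graph_def solution_on_def)
    then have "0 \<in> K" "w 0 = x" using w \<open>X0 \<in> \<C>\<close> unfolding K_def by blast+
    have "is_interval K"
      unfolding is_interval_1
    proof (intro allI impI ballI)
      fix p q s assume "p \<in> K" "q \<in> K" "p \<le> s \<and> s \<le> q"
      moreover have "0 \<le> p" using cover[OF \<open>p \<in> K\<close>] unfolding solution_on_def by auto
      ultimately show "s \<in> K" using cover[OF \<open>q \<in> K\<close>] down by fastforce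
    qed
    have "K \<subseteq> {0..}" using cover unfolding solution_on_def by blast
    have "continuous_on K w"
      unfolding continuous_on_eq_continuous_within
    proof
      fix t assume "t \<in> K"
      from local[OF this] obtain I z where I: "solution_on f a x I z" "t \<in> I" "\<forall>s\<in>I. w s = z s"
        "at t within K = at t within I" by blast
      then have "continuous_on I w"
        using continuous_on_cong[OF refl, of I w z] unfolding solution_on_def by blast
      then show "continuous (at t within K) w"
        using I unfolding continuous_on_eq_continuous_within by simp
    qed
    have "(w has_vector_derivative f (w t) (a t)) (at t within K)"
      if "t \<in> K" "continuous (at t within {0..}) a" for t
    proof -
      from local[OF \<open>t \<in> K\<close>] obtain I z where I: "solution_on f a x I z" "t \<in> I" "\<forall>s\<in>I. w s = z s"
        "at t within K = at t within I" by blast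
      then have "(z has_vector_derivative f (z t) (a t)) (at t within I)"
        using that unfolding solution_on_def by blast
      then show ?thesis
        using has_vector_derivative_transform[of t I w z] I by simp
    qed
    then have "solution_on f a x K w"
      unfolding solution_on_def
      using \<open>is_interval K\<close> \<open>0 \<in> K\<close> \<open>K \<subseteq> {0..}\<close> \<open>w 0 = x\<close> \<open>continuous_on K w\<close> by blast
    then show ?thesis
      unfolding \<A>_def using \<open>\<Union>\<C> = graph K w\<close> \<open>graph J y \<subseteq> graph K w\<close> by blast
  qed
  moreover have "graph J y \<in> \<A>" using sol by (auto simp: \<A>_def)
  ultimately obtain M where M: "M \<in> \<A>" "\<forall>X\<in>\<A>. M \<subseteq> X \<longrightarrow> X = M"
    using subset_Zorn_nonempty[of \<A>] by blast
  then obtain J' y' where J': "M = graph J' y'" "solution_on f a x J' y'" "graph J y \<subseteq> graph J' y'"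
    unfolding \<A>_def by blast
  have "I = J'" if "solution_on f a x I z" "J' \<subseteq> I" "\<forall>t\<in>J'. z t = y' t" for I z
  proof -
    have le: "graph J' y' \<subseteq> graph I z" unfolding sub using that by simp
    then have "graph I z \<in> \<A>" using that J'(3) unfolding \<A>_def by blast
    then have "graph I z = graph J' y'" using M(2) J'(1) le by blast
    then have "fst ` graph I z = fst ` graph J' y'" by simp
    then show ?thesis by (simp add: graph_def image_image)
  qed
  then have "trajectory f a x J' y'" unfolding trajectory_def using J' by blast
  then show ?thesis using J'(3) unfolding sub by blast
qed

lemma two_step_control:
  assumes "a1 \<in> A" "a2 \<in> A"
  shows "(\<lambda>s. if s < \<tau> then a1 else a2) \<in> controls A"
proof -
  let ?a = "\<lambda>s. if s < \<tau> then a1 else a2"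
  have before: "\<forall>\<^sub>F s in nhds t. ?a s = a1" if "t < \<tau>" for t
  proof -
    have "\<forall>\<^sub>F s in nhds t. s \<in> {..<\<tau>}" using that by (intro eventually_nhds_in_open) auto
    then show ?thesis by eventually_elim simp
  qed
  have after: "\<forall>\<^sub>F s in nhds t. ?a s = a2" if "\<tau> < t" for t
  proof -
    have "\<forall>\<^sub>F s in nhds t. s \<in> {\<tau><..}" using that by (intro eventually_nhds_in_open) auto
    then show ?thesis by eventually_elim simp
  qed
  have "continuous (at t within {0..}) ?a" if "t \<noteq> \<tau>" for t
  proof -
    have "\<forall>\<^sub>F s in nhds t. ?a s = ?a t"
      using before[of t] after[of t] that by (cases "t < \<tau>") auto
    then show ?thesis unfolding continuous_within
      by (intro tendsto_eventually filter_leD[OF at_within_le_nhds])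
  qed
  then have "{t\<in>{0..b}. \<not> continuous (at t within {0..}) ?a} \<subseteq> {\<tau>}" for b by blast
  then have "finite {t\<in>{0..b}. \<not> continuous (at t within {0..}) ?a}" for b
    by (rule finite_subset) simp
  moreover have "\<exists>l. (?a \<longlongrightarrow> l) (at_right t)" for t
  proof (cases "t < \<tau>")
    case True
    show ?thesis
      by (rule exI, rule tendsto_eventually, rule filter_leD[OF at_within_le_nhds], rule before[OF True])
  next
    case False
    then have "\<forall>\<^sub>F s in at_right t. ?a s = a2"
      by (auto simp: eventually_at_filter)
    then show ?thesis by (intro exI) (rule tendsto_eventually)
  qed
  moreover have "\<exists>l. (?a \<longlongrightarrow> l) (at_left t)" for t
  proof (cases "\<tau> < t")
    case True
    show ?thesis
      by (rule exI, rule tendsto_eventually, rule filter_leD[OF at_within_le_nhds], rule after[OF True])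
  next
    case False
    then have "\<forall>\<^sub>F s in at_left t. ?a s = a1"
      by (auto simp: eventually_at_filter)
    then show ?thesis by (intro exI) (rule tendsto_eventually)
  qed
  ultimately show ?thesis
    using assms by (auto simp: controls_def piecewise_continuous_def)
qed

section \<open>Growth of a function along two consecutive arcs\<close>

lemma increment_le_of_derivative_le:
  fixes \<phi> \<psi> :: "real \<Rightarrow> real"
  assumes "0 \<le> t"
    and \<phi>: "\<And>s. s \<in> {0..t} \<Longrightarrow> (\<phi> has_real_derivative \<phi>' s) (at s within {0..t})"
    and \<psi>: "\<And>s. (\<psi> has_real_derivative \<psi>' s) (at s)"
    and le: "\<And>s. s \<in> {0..t} \<Longrightarrow> \<phi>' s \<le> \<psi>' s"
  shows "\<phi> t - \<phi> 0 \<le> \<psi> t - \<psi> 0"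
proof -
  have d: "((\<lambda>s. \<phi> s - \<psi> s) has_real_derivative \<phi>' s - \<psi>' s) (at s within {0..t})" if "s \<in> {0..t}" for s
    using \<phi>[OF that] \<psi>[of s] by (intro DERIV_diff) (auto intro: DERIV_subset)
  have "\<phi> 0 - \<psi> 0 \<ge> \<phi> t - \<psi> t"
  proof (rule DERIV_nonpos_imp_decreasing_open[OF \<open>0 \<le> t\<close>])
    show "continuous_on {0..t} (\<lambda>s. \<phi> s - \<psi> s)"
      using d by (meson DERIV_continuous continuous_on_eq_continuous_within)
    fix s assume "0 < s" "s < t"
    then show "\<exists>y. DERIV (\<lambda>s. \<phi> s - \<psi> s) s :> y \<and> y \<le> 0"
      using d[of s] le[of s] at_within_Icc_at[of 0 s t] by auto
  qed
  then show ?thesis by simp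
qed

lemma second_order_upper_bound:
  fixes \<phi> \<gamma> :: "real \<Rightarrow> real"
  assumes t: "0 \<le> t"
    and \<phi>: "\<And>s. s \<in> {0..t} \<Longrightarrow> (\<phi> has_real_derivative \<gamma> s) (at s within {0..t})"
    and \<gamma>: "\<And>s. s \<in> {0..t} \<Longrightarrow> (\<gamma> has_real_derivative \<beta> s) (at s within {0..t})"
    and b: "\<And>s. s \<in> {0..t} \<Longrightarrow> \<beta> s \<le> b"
  shows "\<phi> t \<le> \<phi> 0 + t * \<gamma> 0 + t\<^sup>2 / 2 * b"
proof -
  have "\<gamma> s \<le> \<gamma> 0 + s * b" if "s \<in> {0..t}" for s
  proof -
    have "\<gamma> s - \<gamma> 0 \<le> s * b - 0 * b"
    proof (rule increment_le_of_derivative_le)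
      show "(\<gamma> has_real_derivative \<beta> r) (at r within {0..s})" if "r \<in> {0..s}" for r
        using \<gamma>[of r] that \<open>s \<in> {0..t}\<close> by (auto intro: DERIV_subset)
      show "((\<lambda>s. s * b) has_real_derivative b) (at r)" for r
        by (auto intro!: derivative_eq_intros)
    qed (use that b in auto)
    then show ?thesis by simp
  qed
  then have "\<phi> t - \<phi> 0 \<le> (t * \<gamma> 0 + t\<^sup>2 / 2 * b) - (0 * \<gamma> 0 + 0\<^sup>2 / 2 * b)"
    by (intro increment_le_of_derivative_le[where \<psi> = "\<lambda>s. s * \<gamma> 0 + s\<^sup>2 / 2 * b", OF t \<phi>])
      (auto intro!: derivative_eq_intros)
  then show ?thesis by simp
qed

lemma has_real_derivative_along_curve:
  fixes w :: "'b::real_normed_vector \<Rightarrow> real"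
  assumes "(w has_derivative D) (at (y s))" "(y has_vector_derivative v) (at s within S)"
  shows "((\<lambda>s. w (y s)) has_real_derivative D v) (at s within S)"
proof -
  have "((w \<circ> y) has_derivative D \<circ> (\<lambda>h. h *\<^sub>R v)) (at s within S)"
    using assms unfolding has_vector_derivative_def
    by (intro diff_chain_within) (auto intro: has_derivative_at_withinI)
  moreover have "D (h *\<^sub>R v) = D v * h" for h
    using has_derivative_linear[OF assms(1)] by (simp add: linear_cmul)
  ultimately show ?thesis
    by (simp add: has_field_derivative_def o_def mult_commute_abs)
qed

text \<open>During the first arc \<open>u\<close> grows at rate \<open>g1\<close>, which itself grows at rate at most \<open>p\<close>; during the second
  arc at rate \<open>g2\<close>, which grows at rate at most \<open>q\<close>. At the switch \<open>g2\<close> exceeds its initial value by at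
  most \<open>\<tau> * r\<close>, and integrating this excess over the second arc contributes \<open>\<tau>\<^sup>2 * r\<close>, that is, the
  term \<open>2 * r\<close>.\<close>

lemma two_arc_upper_bound:
  fixes u g1 g2 :: "'b::real_normed_vector \<Rightarrow> real"
  assumes \<tau>: "0 \<le> \<tau>"
    and Du: "\<And>z. (u has_derivative Du z) (at z)"
    and g: "\<And>z. Du z (f1 z) = g1 z" "\<And>z. Du z (f2 z) = g2 z"
    and D1: "\<And>z. (g1 has_derivative D1 z) (at z)" and D2: "\<And>z. (g2 has_derivative D2 z) (at z)"
    and y1: "\<And>s. s \<in> {0..\<tau>} \<Longrightarrow> (y1 has_vector_derivative f1 (y1 s)) (at s within {0..\<tau>})"
    and y2: "\<And>s. s \<in> {0..\<tau>} \<Longrightarrow> (y2 has_vector_derivative f2 (y2 s)) (at s within {0..\<tau>})"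
    and joined: "y2 0 = y1 \<tau>"
    and p: "\<And>s. s \<in> {0..\<tau>} \<Longrightarrow> D1 (y1 s) (f1 (y1 s)) \<le> p"
    and q: "\<And>s. s \<in> {0..\<tau>} \<Longrightarrow> D2 (y2 s) (f2 (y2 s)) \<le> q"
    and r: "\<And>s. s \<in> {0..\<tau>} \<Longrightarrow> D2 (y1 s) (f1 (y1 s)) \<le> r"
  shows "u (y2 \<tau>) \<le> u (y1 0) + \<tau> * (g1 (y1 0) + g2 (y1 0)) + \<tau>\<^sup>2 / 2 * (p + q + 2 * r)"
proof -
  note along = has_real_derivative_along_curve
  have "u (y1 \<tau>) \<le> u (y1 0) + \<tau> * g1 (y1 0) + \<tau>\<^sup>2 / 2 * p"
    using along[OF Du y1] along[OF D1 y1] p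
    by (intro second_order_upper_bound[OF \<tau>, where \<gamma> = "\<lambda>s. g1 (y1 s)"
        and \<beta> = "\<lambda>s. D1 (y1 s) (f1 (y1 s))"]) (auto simp: g)
  moreover have "u (y2 \<tau>) \<le> u (y2 0) + \<tau> * g2 (y2 0) + \<tau>\<^sup>2 / 2 * q"
    using along[OF Du y2] along[OF D2 y2] q
    by (intro second_order_upper_bound[OF \<tau>, where \<gamma> = "\<lambda>s. g2 (y2 s)"
        and \<beta> = "\<lambda>s. D2 (y2 s) (f2 (y2 s))"]) (auto simp: g)
  moreover have "g2 (y1 \<tau>) - g2 (y1 0) \<le> \<tau> * r - 0 * r"
    using along[OF D2 y1] r
    by (intro increment_le_of_derivative_le[OF \<tau>, where \<phi>' = "\<lambda>s. D2 (y1 s) (f1 (y1 s))"])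
      (auto intro!: derivative_eq_intros)
  then have "\<tau> * g2 (y1 \<tau>) \<le> \<tau> * (g2 (y1 0) + \<tau> * r)"
    using \<tau> by (intro mult_left_mono) auto
  ultimately show ?thesis
    using joined by (simp add: field_simps power2_eq_square)
qed

lemma linear_growth_of_has_derivative:
  fixes w :: "'b::real_normed_vector \<Rightarrow> real"
  assumes "(w has_derivative D) (at c)"
  obtains G r where "G > 0" "r > 0" "\<And>x. norm (x - c) \<le> r \<Longrightarrow> w x - w c \<le> G * norm (x - c)"
proof -
  have bl: "bounded_linear D" using assms by (rule has_derivative_bounded_linear)
  then obtain K where K: "K > 0" "\<And>h. norm (D h) \<le> norm h * K"
    using bounded_linear.pos_bounded by blast
  obtain d where "d > 0" and d: "\<And>x. norm (x - c) < d \<Longrightarrow> norm (w x - w c - D (x - c)) \<le> 1 * norm (x - c)"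
    using assms unfolding has_derivative_at_alt by (meson zero_less_one)
  have "w x - w c \<le> (K + 1) * norm (x - c)" if "norm (x - c) \<le> d / 2" for x
    using d[of x] K(2)[of "x - c"] that \<open>d > 0\<close> by (simp add: algebra_simps)
  then show ?thesis using that[of "K + 1" "d / 2"] K(1) \<open>d > 0\<close> by simp
qed

lemma class_C_lipschitz_on_cball:
  fixes g :: "real^'n::finite \<Rightarrow> real^'n"
  assumes "class_C 1 g"
  obtains L where "L \<ge> 0"
    "\<And>x y. x \<in> cball c R \<Longrightarrow> y \<in> cball c R \<Longrightarrow> norm (g x - g y) \<le> L * norm (x - y)"
proof -
  have "compact (jac g ` cball c R)"
    using isCont_jac[OF assms]
    by (intro compact_continuous_image continuous_at_imp_continuous_on) auto
  then obtain B where B: "\<And>x. x \<in> cball c R \<Longrightarrow> norm (jac g x) \<le> B" and "B > 0"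
    using compact_imp_bounded bounded_pos by (metis imageI)
  define L where "L = real CARD('n) * real CARD('n) * B"
  have "onorm ((*v) (jac g x)) \<le> L" if "x \<in> cball c R" for x
    unfolding L_def
  proof (rule onorm_le_matrix_component)
    fix i j
    have "\<bar>jac g x $ i $ j\<bar> \<le> norm (jac g x $ i)" by (rule component_le_norm_cart)
    also have "\<dots> \<le> norm (jac g x)" by (rule Finite_Cartesian_Product.norm_nth_le)
    finally show "\<bar>jac g x $ i $ j\<bar> \<le> B" using B[OF that] by simp
  qed
  then have "norm (g x - g y) \<le> L * norm (x - y)" if "x \<in> cball c R" "y \<in> cball c R" for x y
    using that has_derivative_at_withinI[OF has_derivative_jac[OF assms]]
    by (intro differentiable_bound[where S = "cball c R" and f' = "\<lambda>x. (*v) (jac g x)"]) auto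
  then show ?thesis using that[of L] \<open>B > 0\<close> by (simp add: L_def)
qed

lemma class_C_bounded_on_cball:
  fixes g :: "real^'n::finite \<Rightarrow> real^'n"
  assumes "class_C k g"
  obtains M where "M \<ge> 0" "\<And>x. x \<in> cball c R \<Longrightarrow> norm (g x) \<le> M"
proof -
  have "compact (g ` cball c R)"
    using class_C_continuous[OF assms]
    by (intro compact_continuous_image continuous_at_imp_continuous_on) auto
  then show ?thesis using that
    using compact_imp_bounded bounded_pos by (metis imageI less_le)
qed


section \<open>Second variation of a function along two vector fields\<close>

lemma trace_matrix_mult_outer: "trace (H ** outer p q) = (H *v p) \<bullet> q"
  by (simp add: trace_def matrix_matrix_mult_def outer_def matrix_vector_mult_def inner_vec_def
      sum_distrib_right mult.assoc)

lemma tendsto_matrix_vector_mult: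
  fixes M :: "'b \<Rightarrow> real^'n::finite^'k::finite"
  assumes "(M \<longlongrightarrow> M0) F" "(v \<longlongrightarrow> v0) F"
  shows "((\<lambda>z. M z *v v z) \<longlongrightarrow> M0 *v v0) F"
proof (rule vec_tendstoI)
  fix i
  have "((\<lambda>z. \<Sum>j\<in>UNIV. M z $ i $ j * v z $ j) \<longlongrightarrow> (\<Sum>j\<in>UNIV. M0 $ i $ j * v0 $ j)) F"
    by (rule tendsto_sum tendsto_mult tendsto_vec_nth assms)+
  then show "((\<lambda>z. (M z *v v z) $ i) \<longlongrightarrow> (M0 *v v0) $ i) F"
    by (simp add: matrix_vector_mult_def)
qed

definition lie_derivative ::
  "(real^'n::finite \<Rightarrow> real) \<Rightarrow> (real^'n \<Rightarrow> real^'n) \<Rightarrow> real^'n \<Rightarrow> real" where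
  "lie_derivative u f x = grad u x \<bullet> f x"

text \<open>The differential of \<open>lie_derivative u f\<close> at \<open>x\<close> in direction \<open>h\<close>; for \<open>h = g x\<close> it is the iterated Lie
  derivative of \<open>u\<close>, first along \<open>f\<close> and then along \<open>g\<close>.\<close>

definition lie_derivative_deriv ::
  "(real^'n::finite \<Rightarrow> real) \<Rightarrow> (real^'n \<Rightarrow> real^'n) \<Rightarrow> real^'n \<Rightarrow> real^'n \<Rightarrow> real" where
  "lie_derivative_deriv u f x h = grad u x \<bullet> (jac f x *v h) + (hessian u x *v h) \<bullet> f x"

lemma has_derivative_lie_derivative:
  assumes "class_C 2 u" "class_C 1 f"
  shows "(lie_derivative u f has_derivative lie_derivative_deriv u f x) (at x)"
proof -
  have "((\<lambda>x. grad u x \<bullet> f x) has_derivative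
      (\<lambda>h. grad u x \<bullet> (jac f x *v h) + (hessian u x *v h) \<bullet> f x)) (at x)"
    by (rule has_derivative_inner[OF has_derivative_hessian has_derivative_jac]) (fact assms)+
  then show ?thesis by (simp add: lie_derivative_def[abs_def] lie_derivative_deriv_def[abs_def])
qed

lemma isCont_lie_derivative_deriv:
  assumes u: "class_C 2 u" and f: "class_C 1 f" and g: "class_C 1 g"
  shows "isCont (\<lambda>x. lie_derivative_deriv u f x (g x)) x"
proof -
  have "isCont (grad u) x" using has_derivative_continuous[OF has_derivative_hessian[OF u]] .
  then show ?thesis
    using isCont_jac[OF f, of x] isCont_hessian[OF u, of x]
      class_C_continuous[OF f, of x] class_C_continuous[OF g, of x]
    unfolding lie_derivative_deriv_def isCont_def
    by (intro tendsto_intros tendsto_matrix_vector_mult)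
qed

text \<open>The Jacobian terms on the left are \<open>(Df\<^sub>1 + Df\<^sub>2)(f\<^sub>1 + f\<^sub>2) + Df\<^sub>2 f\<^sub>1 - Df\<^sub>1 f\<^sub>2\<close>. The bracket cancels
  \<open>Df\<^sub>1 f\<^sub>2\<close> and doubles \<open>Df\<^sub>2 f\<^sub>1\<close>: it records that \<open>f\<^sub>1\<close> is followed before \<open>f\<^sub>2\<close>.\<close>

lemma second_variation_two_arcs:
  assumes u: "class_C 2 u" and f1: "class_C 1 f1" and f2: "class_C 1 f2"
  defines "F \<equiv> \<lambda>x. f1 x + f2 x"
  shows "trace (hessian u x ** outer (F x) (F x)) + (jac F x *v F x + lie_bracket f1 f2 x) \<bullet> grad u x
    = lie_derivative_deriv u f1 x (f1 x) + lie_derivative_deriv u f2 x (f2 x)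
      + 2 * lie_derivative_deriv u f2 x (f1 x)"
proof -
  have sym: "(hessian u x *v p) \<bullet> q = (hessian u x *v q) \<bullet> p" for p q
  proof -
    have "transpose (hessian u x) = hessian u x"
      by (simp add: transpose_def vec_eq_iff hessian_symmetric[OF u])
    then show ?thesis
      using dot_lmul_matrix[of p "hessian u x" q] transpose_matrix_vector[of "hessian u x" p]
      by (simp add: inner_commute)
  qed
  have "jac F x = jac f1 x + jac f2 x" unfolding F_def by (rule jac_add[OF f1 f2])
  then show ?thesis
    using sym[of "f1 x" "f2 x"]
    by (simp only: trace_matrix_mult_outer F_def lie_bracket_def lie_derivative_deriv_def
        matrix_vector_right_distrib matrix_vector_mult_add_rdistrib inner_add_left inner_add_right
        inner_diff_left inner_commute[of "grad u x"]) simp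
qed

section \<open>Attainability in square root time\<close>

text \<open>The common source of both conclusions. The hitting time is prescribed exactly, not just bounded,
  because the two-arc motion is run for precisely that time; at \<open>x = c\<close> it is 0.\<close>

definition attained_in_sqrt_time ::
  "('x::real_normed_vector \<Rightarrow> 'a::topological_space \<Rightarrow> 'x) \<Rightarrow> 'a set \<Rightarrow> 'x set \<Rightarrow> 'x \<Rightarrow> real \<Rightarrow> real \<Rightarrow> bool"
  where
  "attained_in_sqrt_time f A S c C r \<longleftrightarrow> (\<forall>x. norm (x - c) \<le> r \<longrightarrow>
     (\<exists>a\<in>controls A. \<exists>J y. trajectory f a x J y \<and>
        C * sqrt (norm (x - c)) \<in> J \<and> y (C * sqrt (norm (x - c))) \<in> S))"

lemma attained_in_sqrt_time_imp_min_time_le: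
  assumes "attained_in_sqrt_time f A S c C r" "norm (x - c) \<le> r"
  shows "min_time f A S x \<le> ereal (C * sqrt (norm (x - c)))"
proof -
  obtain a J y where a: "a \<in> controls A" "trajectory f a x J y"
    "C * sqrt (norm (x - c)) \<in> J" "y (C * sqrt (norm (x - c))) \<in> S"
    using assms unfolding attained_in_sqrt_time_def by blast
  then have "hitting_time f S a x \<le> ereal (C * sqrt (norm (x - c)))"
    unfolding hitting_time_def by (intro Inf_lower) blast
  then show ?thesis unfolding min_time_def using a(1) by (rule INF_lower2[rotated])
qed

lemma attained_in_sqrt_time_imp_STLA:
  assumes att: "attained_in_sqrt_time f A S c C r" and "C > 0" "r > 0"
  shows "STLA f A S c"
  unfolding STLA_def
proof (intro allI impI)
  fix t :: real assume "t > 0"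
  define d where "d = min r ((t / C)\<^sup>2)"
  have "d > 0" using \<open>t > 0\<close> \<open>C > 0\<close> \<open>r > 0\<close> by (simp add: d_def)
  have "ball c d \<subseteq> reach_within f A S t"
  proof
    fix x assume "x \<in> ball c d"
    then have x: "norm (x - c) < d" by (simp add: dist_norm norm_minus_commute)
    then have "sqrt (norm (x - c)) < t / C"
      using \<open>t > 0\<close> \<open>C > 0\<close> by (intro real_less_lsqrt) (auto simp: d_def)
    then have "C * sqrt (norm (x - c)) < t" using \<open>C > 0\<close> by (simp add: field_simps)
    moreover have "norm (x - c) \<le> r" using x by (simp add: d_def)
    ultimately show "x \<in> reach_within f A S t"
      using att unfolding attained_in_sqrt_time_def reach_within_def by blast
  qed
  then show "c \<in> interior (reach_within f A S t)"
    using \<open>d > 0\<close> by (meson centre_in_ball interiorI open_ball)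
qed

lemma isCont_upper_bound_near:
  fixes w :: "'b::metric_space \<Rightarrow> real"
  assumes "isCont w c" "\<epsilon> > 0"
  obtains R where "R > 0" "\<And>x. x \<in> cball c R \<Longrightarrow> w x \<le> w c + \<epsilon>"
proof -
  obtain d where "d > 0" and d: "\<And>x. dist x c < d \<Longrightarrow> dist (w x) (w c) < \<epsilon>"
    using assms unfolding continuous_at_eps_delta by blast
  have "w x \<le> w c + \<epsilon>" if "x \<in> cball c (d / 2)" for x
  proof -
    have "dist x c < d" using that \<open>d > 0\<close> by (simp add: dist_commute)
    then show ?thesis using d[of x] by (simp add: dist_real_def)
  qed
  then show ?thesis using that[of "d / 2"] \<open>d > 0\<close> by simp
qed

text \<open>The criterion for a fixed pair of controls, by the balance described at the beginning: the linear terms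
  are at most \<open>(G1 + G2) d\<close> as long as \<open>\<tau> \<le> 1\<close>, and \<open>K\<close> is chosen so that the quadratic gain
  \<open>\<kappa> \<tau>\<^sup>2\<close> equals that amount for \<open>\<tau> = K \<surd>d\<close>.\<close>

lemma two_arcs_attain_in_sqrt_time:
  fixes f :: "real^'n::finite \<Rightarrow> 'a::t2_space \<Rightarrow> real^'n"
  assumes a: "a1 \<in> A" "a2 \<in> A"
    and f1: "class_C 1 (\<lambda>x. f x a1)" and f2: "class_C 1 (\<lambda>x. f x a2)"
    and u: "class_C 2 u"
    and crit: "grad u c \<bullet> f c a1 = 0" "grad u c \<bullet> f c a2 = 0"
    and neg: "lie_derivative_deriv u (\<lambda>x. f x a1) c (f c a1)
       + lie_derivative_deriv u (\<lambda>x. f x a2) c (f c a2)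
       + 2 * lie_derivative_deriv u (\<lambda>x. f x a2) c (f c a1) < 0"
  shows "\<exists>C>0. \<exists>r>0. attained_in_sqrt_time f A {x. u x \<le> u c} c C r"
proof -
  let ?f1 = "\<lambda>x. f x a1" and ?f2 = "\<lambda>x. f x a2"
  let ?D1 = "lie_derivative_deriv u ?f1" and ?D2 = "lie_derivative_deriv u ?f2"
  let ?g1 = "lie_derivative u ?f1" and ?g2 = "lie_derivative u ?f2"
  define Q where "Q = ?D1 c (?f1 c) + ?D2 c (?f2 c) + 2 * ?D2 c (?f1 c)"
  have "Q < 0" using neg by (simp add: Q_def)
  \<comment> \<open>The bounds on the ball cost four times \<open>\<epsilon>\<close>, which is half of \<open>- Q\<close>; the factor 1/2 of the second-order term leaves \<open>\<kappa>\<close>.\<close>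
  define \<kappa> where "\<kappa> = - Q / 4"
  define \<epsilon> where "\<epsilon> = \<kappa> / 2"
  have \<kappa>: "\<kappa> > 0" "\<epsilon> > 0" using \<open>Q < 0\<close> by (auto simp: \<kappa>_def \<epsilon>_def)
  obtain R1 where R1: "R1 > 0" "\<And>x. x \<in> cball c R1 \<Longrightarrow> ?D1 x (?f1 x) \<le> ?D1 c (?f1 c) + \<epsilon>"
    using isCont_upper_bound_near[OF isCont_lie_derivative_deriv[OF u f1 f1] \<kappa>(2)] by blast
  obtain R2 where R2: "R2 > 0" "\<And>x. x \<in> cball c R2 \<Longrightarrow> ?D2 x (?f2 x) \<le> ?D2 c (?f2 c) + \<epsilon>"
    using isCont_upper_bound_near[OF isCont_lie_derivative_deriv[OF u f2 f2] \<kappa>(2)] by blast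
  obtain R3 where R3: "R3 > 0" "\<And>x. x \<in> cball c R3 \<Longrightarrow> ?D2 x (?f1 x) \<le> ?D2 c (?f1 c) + \<epsilon>"
    using isCont_upper_bound_near[OF isCont_lie_derivative_deriv[OF u f2 f1] \<kappa>(2)] by blast
  define R where "R = min R1 (min R2 R3)"
  have "R > 0" using R1 R2 R3 by (simp add: R_def)
  obtain L1 where L1: "L1 \<ge> 0"
    "\<And>x y. x \<in> cball c R \<Longrightarrow> y \<in> cball c R \<Longrightarrow> norm (?f1 x - ?f1 y) \<le> L1 * norm (x - y)"
    using class_C_lipschitz_on_cball[OF f1] by blast
  obtain L2 where L2: "L2 \<ge> 0"
    "\<And>x y. x \<in> cball c R \<Longrightarrow> y \<in> cball c R \<Longrightarrow> norm (?f2 x - ?f2 y) \<le> L2 * norm (x - y)"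
    using class_C_lipschitz_on_cball[OF f2] by blast
  obtain M1 where M1: "M1 \<ge> 0" "\<And>x. x \<in> cball c R \<Longrightarrow> norm (?f1 x) \<le> M1"
    using class_C_bounded_on_cball[OF f1] by blast
  obtain M2 where M2: "M2 \<ge> 0" "\<And>x. x \<in> cball c R \<Longrightarrow> norm (?f2 x) \<le> M2"
    using class_C_bounded_on_cball[OF f2] by blast
  have "class_C 1 u" using u by (rule class_C_mono) simp
  note Du = has_derivative_grad[OF this]
  note D1 = has_derivative_lie_derivative[OF u f1] and D2 = has_derivative_lie_derivative[OF u f2]
  obtain G1 r1 where G1: "G1 > 0" "r1 > 0" "\<And>x. norm (x - c) \<le> r1 \<Longrightarrow> u x - u c \<le> G1 * norm (x - c)"
    using linear_growth_of_has_derivative[OF Du] by blast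
  obtain G2 r2 where G2: "G2 > 0" "r2 > 0" "\<And>x. norm (x - c) \<le> r2 \<Longrightarrow>
      (?g1 x + ?g2 x) - (?g1 c + ?g2 c) \<le> G2 * norm (x - c)"
    using linear_growth_of_has_derivative[OF has_derivative_add[OF D1 D2]] by blast
  have "?g1 c + ?g2 c = 0" using crit by (simp add: lie_derivative_def)
  define K where "K = sqrt ((G1 + G2) / \<kappa>)"
  have "K > 0" using G1 G2 \<kappa> by (simp add: K_def)
  have K2: "K\<^sup>2 * \<kappa> = G1 + G2" using G1 G2 \<kappa> by (simp add: K_def)
  \<comment> \<open>Short enough for both Picard maps to contract and for the two arcs together to move the state by at most \<open>R / 2\<close>.\<close>
  define \<tau>0 where "\<tau>0 = min 1 (min (1 / (L1 + L2 + 1)) (R / (2 * (M1 + M2 + 1)))) / 2"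
  have "\<tau>0 > 0" using \<open>R > 0\<close> L1 L2 M1 M2 by (simp add: \<tau>0_def)
  define r where "r = min (min r1 r2) (min (R / 2) ((\<tau>0 / K)\<^sup>2))"
  have "r > 0" using G1 G2 \<open>R > 0\<close> \<open>\<tau>0 > 0\<close> \<open>K > 0\<close> by (simp add: r_def)
  have "\<exists>a\<in>controls A. \<exists>J y. trajectory f a x J y \<and> 2 * K * sqrt (norm (x - c)) \<in> J \<and>
      y (2 * K * sqrt (norm (x - c))) \<in> {x. u x \<le> u c}" if x: "norm (x - c) \<le> r" for x
  proof -
    define d where "d = norm (x - c)"
    define \<tau> where "\<tau> = K * sqrt d"
    have d: "0 \<le> d" "d \<le> r1" "d \<le> r2" "d \<le> R / 2" "d \<le> (\<tau>0 / K)\<^sup>2"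
      using x by (auto simp: d_def r_def)
    have "\<tau> \<ge> 0" using \<open>K > 0\<close> d by (simp add: \<tau>_def)
    have "sqrt d \<le> \<tau>0 / K"
      using d \<open>\<tau>0 > 0\<close> \<open>K > 0\<close> by (intro real_le_lsqrt) auto
    then have "\<tau> \<le> \<tau>0" using \<open>K > 0\<close> by (simp add: \<tau>_def field_simps)
    moreover have "2 * \<tau>0 \<le> 1" "2 * \<tau>0 \<le> 1 / (L1 + L2 + 1)" "2 * \<tau>0 \<le> R / (2 * (M1 + M2 + 1))"
      by (simp_all add: \<tau>0_def min.coboundedI1 min.coboundedI2 del: distrib_left_numeral)
    ultimately have \<tau>: "\<tau> \<le> 1" "\<tau> < 1 / (L1 + L2 + 1)" "\<tau> \<le> R / (2 * (M1 + M2 + 1))"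
      using \<open>\<tau>0 > 0\<close> by linarith+
    have "(L1 + L2 + 1) * \<tau> < 1" using \<tau>(2) L1 L2 by (simp add: field_simps)
    moreover have "0 \<le> L1 * \<tau>" "0 \<le> L2 * \<tau>" using L1 L2 \<open>\<tau> \<ge> 0\<close> by auto
    ultimately have L\<tau>: "L1 * \<tau> < 1" "L2 * \<tau> < 1"
      using \<open>\<tau> \<ge> 0\<close> by (auto simp: distrib_right)
    have "(M1 + M2 + 1) * \<tau> \<le> R / 2" using \<tau>(3) M1 M2 by (simp add: field_simps)
    then have M\<tau>: "M1 * \<tau> + M2 * \<tau> \<le> R / 2" using \<open>\<tau> \<ge> 0\<close> by (simp add: distrib_right)
    have M0: "0 \<le> M1 * \<tau>" "0 \<le> M2 * \<tau>" using M1 M2 \<open>\<tau> \<ge> 0\<close> by auto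
    have start1: "norm (x - c) + M1 * \<tau> \<le> R" using d M\<tau> M0 \<open>R > 0\<close> unfolding d_def by linarith
    have "\<exists>y. y 0 = x \<and> (\<forall>t\<in>{0..\<tau>}. norm (y t - x) \<le> M1 * \<tau> \<and>
        (y has_vector_derivative ?f1 (y t)) (at t within {0..\<tau>}))"
      by (rule lipschitz_flow_in_ball[where c = c and R = R and L = L1])
        (fact L1 M1 \<open>\<tau> \<ge> 0\<close> L\<tau> start1)+
    then obtain y1 where y1: "y1 0 = x" "\<And>t. t \<in> {0..\<tau>} \<Longrightarrow> norm (y1 t - x) \<le> M1 * \<tau>"
      "\<And>t. t \<in> {0..\<tau>} \<Longrightarrow> (y1 has_vector_derivative ?f1 (y1 t)) (at t within {0..\<tau>})"
      by blast
    have y1c: "norm (y1 t - c) \<le> d + M1 * \<tau>" if "t \<in> {0..\<tau>}" for t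
      using y1(2)[OF that] norm_triangle_ineq[of "y1 t - x" "x - c"] by (simp add: d_def)
    have y1\<tau>: "norm (y1 \<tau> - c) \<le> d + M1 * \<tau>" using y1c[of \<tau>] \<open>\<tau> \<ge> 0\<close> by simp
    have start2: "norm (y1 \<tau> - c) + M2 * \<tau> \<le> R" using y1\<tau> d M\<tau> by linarith
    have "\<exists>y. y 0 = y1 \<tau> \<and> (\<forall>t\<in>{0..\<tau>}. norm (y t - y1 \<tau>) \<le> M2 * \<tau> \<and>
        (y has_vector_derivative ?f2 (y t)) (at t within {0..\<tau>}))"
      by (rule lipschitz_flow_in_ball[where c = c and R = R and L = L2])
        (fact L2 M2 \<open>\<tau> \<ge> 0\<close> L\<tau> start2)+
    then obtain y2 where y2: "y2 0 = y1 \<tau>" "\<And>t. t \<in> {0..\<tau>} \<Longrightarrow> norm (y2 t - y1 \<tau>) \<le> M2 * \<tau>"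
      "\<And>t. t \<in> {0..\<tau>} \<Longrightarrow> (y2 has_vector_derivative ?f2 (y2 t)) (at t within {0..\<tau>})"
      by blast
    have y2c: "norm (y2 t - c) \<le> d + M1 * \<tau> + M2 * \<tau>" if "t \<in> {0..\<tau>}" for t
      using y2(2)[OF that] y1\<tau> norm_triangle_ineq[of "y2 t - y1 \<tau>" "y1 \<tau> - c"] by simp
    have in1: "y1 t \<in> cball c R" if "t \<in> {0..\<tau>}" for t
      using y1c[OF that] d M\<tau> M0 by (simp add: dist_norm norm_minus_commute)
    have in2: "y2 t \<in> cball c R" if "t \<in> {0..\<tau>}" for t
      using y2c[OF that] d M\<tau> M0 by (simp add: dist_norm norm_minus_commute)
    have "u (y2 \<tau>) \<le> u (y1 0) + \<tau> * (?g1 (y1 0) + ?g2 (y1 0)) + \<tau>\<^sup>2 / 2 *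
        ((?D1 c (?f1 c) + \<epsilon>) + (?D2 c (?f2 c) + \<epsilon>) + 2 * (?D2 c (?f1 c) + \<epsilon>))"
      by (rule two_arc_upper_bound[OF \<open>\<tau> \<ge> 0\<close> Du _ _ D1 D2 y1(3) y2(3) y2(1)])
        (use R1(2) R2(2) R3(2) in1 in2 in \<open>auto simp: lie_derivative_def R_def\<close>)
    also have "\<dots> = u x + \<tau> * (?g1 x + ?g2 x) - \<tau>\<^sup>2 * \<kappa>"
      using y1(1) by (simp add: \<kappa>_def \<epsilon>_def Q_def field_simps)
    also have "\<dots> \<le> (u c + G1 * d) + 1 * (G2 * d) - \<tau>\<^sup>2 * \<kappa>"
    proof -
      have "?g1 x + ?g2 x \<le> G2 * d" using G2(3)[of x] d \<open>?g1 c + ?g2 c = 0\<close> by (simp add: d_def)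
      then have "\<tau> * (?g1 x + ?g2 x) \<le> \<tau> * (G2 * d)" using \<open>\<tau> \<ge> 0\<close> by (rule mult_left_mono)
      also have "\<dots> \<le> 1 * (G2 * d)" using \<tau> G2 d by (intro mult_right_mono) auto
      finally show ?thesis using G1(3)[of x] d by (simp add: d_def)
    qed
    also have "\<tau>\<^sup>2 * \<kappa> = d * (K\<^sup>2 * \<kappa>)" using d by (simp add: \<tau>_def power_mult_distrib)
    also have "u c + G1 * d + 1 * (G2 * d) - \<dots> = u c" unfolding K2 by (simp add: algebra_simps)
    finally have final: "u (y2 \<tau>) \<le> u c" .
    let ?a = "\<lambda>s. if s < \<tau> then a1 else a2" and ?y = "\<lambda>s. if s \<le> \<tau> then y1 s else y2 (s - \<tau>)"
    have sol: "solution_on f ?a x {0..\<tau> + \<tau>} ?y"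
      using \<open>\<tau> \<ge> 0\<close> y1(1,3) y2(1,3)
      by - (rule solution_on_concat[where f = f and ?y1.0 = y1 and ?y2.0 = y2]; blast)
    obtain J y where J: "trajectory f ?a x J y" "{0..\<tau> + \<tau>} \<subseteq> J"
      and y: "\<And>t. t \<in> {0..\<tau> + \<tau>} \<Longrightarrow> y t = ?y t"
      using solution_extends_to_trajectory[OF sol] by blast
    \<comment> \<open>For \<open>\<tau> = 0\<close> the concatenation takes its end value from the first arc.\<close>
    have "?y (\<tau> + \<tau>) = y2 \<tau>" using y2(1) \<open>\<tau> \<ge> 0\<close> by (cases "\<tau> = 0") auto
    then have "u (y (\<tau> + \<tau>)) \<le> u c" using y[of "\<tau> + \<tau>"] final \<open>\<tau> \<ge> 0\<close> by simp
    moreover have "\<tau> + \<tau> \<in> J" using J(2) \<open>\<tau> \<ge> 0\<close> by auto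
    moreover have "2 * K * sqrt (norm (x - c)) = \<tau> + \<tau>" by (simp add: \<tau>_def d_def)
    ultimately have "trajectory f ?a x J y \<and> 2 * K * sqrt (norm (x - c)) \<in> J \<and>
        y (2 * K * sqrt (norm (x - c))) \<in> {x. u x \<le> u c}"
      using J(1) by (simp only: mem_Collect_eq)
    then show ?thesis using two_step_control[OF a, of \<tau>] by blast
  qed
  then have "attained_in_sqrt_time f A {x. u x \<le> u c} c (2 * K) r"
    unfolding attained_in_sqrt_time_def by blast
  moreover have "2 * K > 0" using \<open>K > 0\<close> by simp
  ultimately show ?thesis using \<open>r > 0\<close> by blast
qed

theorem theorem3p1:
  fixes A :: "(real^'m) set"
    and f :: "real^'n \<Rightarrow> real^'m \<Rightarrow> real^'n"
    and u :: "real^'n \<Rightarrow> real"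
    and xb :: "real^'n"
    and F :: "real^'m \<Rightarrow> real^'m \<Rightarrow> real^'n \<Rightarrow> real^'n"
  assumes "compact A" and "A \<noteq> {}"
    and "spatial_class_C 2 A f"
    and "class_C 3 u"
    and "grad u xb \<noteq> 0"
    and "\<And>a. a \<in> A \<Longrightarrow> grad u xb \<bullet> f xb a = 0"
    and F_def: "\<And>a1 a2 x. F a1 a2 x = f x a1 + f x a2"
    and "(SUP (a1, a2)\<in>A \<times> A.
            - trace (hessian u xb ** outer (F a1 a2 xb) (F a1 a2 xb))
            - (jac (F a1 a2) xb *v F a1 a2 xb
               + lie_bracket (\<lambda>x. f x a1) (\<lambda>x. f x a2) xb) \<bullet> grad u xb) > 0"
  shows "STLA f A {x. u x \<le> u xb} xb
    \<and> (\<exists>C>0. \<exists>r>0. \<forall>x. norm (x - xb) \<le> r \<longrightarrow>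
          min_time f A {x. u x \<le> u xb} x \<le> ereal (C * sqrt (norm (x - xb))))"
proof -
  let ?W = "\<lambda>(a1, a2). - trace (hessian u xb ** outer (F a1 a2 xb) (F a1 a2 xb))
            - (jac (F a1 a2) xb *v F a1 a2 xb
               + lie_bracket (\<lambda>x. f x a1) (\<lambda>x. f x a2) xb) \<bullet> grad u xb"
  have "\<exists>q\<in>A \<times> A. ?W q > 0"
  proof (rule ccontr)
    assume "\<not> ?thesis"
    then have "(SUP q\<in>A \<times> A. ?W q) \<le> 0"
      using \<open>A \<noteq> {}\<close> by (intro cSUP_least) (auto simp: not_less)
    then show False using assms(8) by simp
  qed
  then obtain a1 a2 where a: "a1 \<in> A" "a2 \<in> A" and W: "?W (a1, a2) > 0" by blast
  have f: "class_C 1 (\<lambda>x. f x a)" if "a \<in> A" for a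
    using spatial_class_C_imp_class_C[OF assms(3) that] by (rule class_C_mono) simp
  have u: "class_C 2 u" using assms(4) by (rule class_C_mono) simp
  have F: "F a1 a2 = (\<lambda>x. f x a1 + f x a2)" by (simp add: F_def fun_eq_iff)
  have "lie_derivative_deriv u (\<lambda>x. f x a1) xb (f xb a1)
       + lie_derivative_deriv u (\<lambda>x. f x a2) xb (f xb a2)
       + 2 * lie_derivative_deriv u (\<lambda>x. f x a2) xb (f xb a1) < 0"
    using W second_variation_two_arcs[OF u f[OF a(1)] f[OF a(2)], of xb] by (simp add: F)
  from two_arcs_attain_in_sqrt_time[where f = f, OF a f[OF a(1)] f[OF a(2)] u assms(6)[OF a(1)] assms(6)[OF a(2)] this]
  obtain C r where "C > 0" "r > 0" and att: "attained_in_sqrt_time f A {x. u x \<le> u xb} xb C r"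
    by blast
  then show ?thesis
    using attained_in_sqrt_time_imp_STLA[OF att] attained_in_sqrt_time_imp_min_time_le[OF att] by blast
qed

end
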